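(* Let $N$ be a Liouville torus of an integrable system $(X_1,\ldots,X_p,F_1,\ldots,F_q)$ on a manifold $M$, such that in a tubular neighborhood $\mathcal{U}(N)\cong\mathbb{T}^p\times B^q$ of $N$ (whose Liouville tori are the $\mathbb{T}^p\times\{\mathbf{z}\}$) the set of points $\mathbf{z}\in B^q$ such that the orbits of the vector field $X_1$ on the Liouville torus $\mathbb{T}^p\times\{\mathbf{z}\}$ are dense in this torus is a dense subset of $B^q$. Then any tensor field $\mathcal{G}\in\Gamma(\otimes^hTM\otimes^kT^*M)$ which is invariant with respect to $X_1$ (i.e. $\mathcal{L}_{X_1}\mathcal{G}=0$) is also invariant with respect to the Liouville torus $\mathbb{T}^p$-action on $\mathcal{U}(N)$.
   Context: All objects are smooth. An integrable system of type $(p,q)$ ($p\ge1$, $q\ge0$) on a manifold $M$ of dimension $m=p+q$ is a tuple $(X_1,\ldots,X_p,F_1,\ldots,F_q)$ of vector fields $X_i$ and functions $F_j$ on $M$ such that $[X_i,X_j]=0$ for all $i,j$; $X_i(F_j)=0$ for all $i,j$; and $X_1\wedge\cdots\wedge X_p\ne0$, $dF_1\wedge\cdots\wedge dF_q\neq0$ almost everywhere on $M$. A level set is a connected component $N$ of a joint level set $\{F_1=\mathrm{const},\ldots,F_q=\mathrm{const}\}$; the system is regular at $N$ if $X_1\wedge\cdots\wedge X_p\neq0$ and $dF_1\wedge\cdots\wedge dF_q\neq0$ everywhere on $N$. A Liouville torus is a compact level set at which the system is regular. By Liouville's theorem, a tubular neighborhood $\mathcal{U}(N)$ of a Liouville torus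 $N$ carries a free $\mathbb{T}^p$-action, unique up to automorphisms of $\mathbb{T}^p$, which preserves every $X_i$ and every $F_j$ and whose orbits are regular level sets of the system; it is called the Liouville torus action. Moreover $\mathcal{U}(N)\cong\mathbb{T}^p\times B^q$ ($B^q$ a $q$-dimensional ball) with coordinates $(\theta_1 \bmod 1,\ldots,\theta_p \bmod 1,z_1,\ldots,z_q)$ in which the action is generated by $\partial/\partial\theta_1,\ldots,\partial/\partial\theta_p$, the $F_j$ depend only on $z$, and $X_i=\sum_j a_{ij}(z)\,\partial/\partial\theta_j$. *)

theory Defs
  imports "HOL-Analysis.Analysis"
begin

subsection \<open>Smooth functions on open sets\<close>

fun Ck_on :: "nat \<Rightarrow> 'a::real_normed_vector set \<Rightarrow> ('a \<Rightarrow> 'b::real_normed_vector) \<Rightarrow> bool" where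
  "Ck_on 0 S f \<longleftrightarrow> continuous_on S f"
| "Ck_on (Suc n) S f \<longleftrightarrow>
     (\<forall>x\<in>S. f differentiable (at x)) \<and>
     (\<forall>v. Ck_on n S (\<lambda>x. frechet_derivative f (at x) v))"

definition smooth_on :: "'a::real_normed_vector set \<Rightarrow> ('a \<Rightarrow> 'b::real_normed_vector) \<Rightarrow> bool" where
  "smooth_on S f \<longleftrightarrow> (\<forall>n. Ck_on n S f)"

subsection \<open>Smooth manifolds\<close>

text \<open>
  A chart is a domain together with a map into the model space; the values of the map
  outside the domain are irrelevant.
\<close>

type_synonym ('m, 'e) chart = "'m set \<times> ('m \<Rightarrow> 'e)"

abbreviation cdom :: "('m, 'e) chart \<Rightarrow> 'm set" where "cdom \<equiv> fst"
abbreviation cmap :: "('m, 'e) chart \<Rightarrow> 'm \<Rightarrow> 'e" where "cmap \<equiv> snd"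

definition cinv :: "('m, 'e) chart \<Rightarrow> 'e \<Rightarrow> 'm" where
  "cinv c = inv_into (cdom c) (cmap c)"

definition is_chart :: "('m::topological_space, 'e::euclidean_space) chart \<Rightarrow> bool" where
  "is_chart c \<longleftrightarrow> open (cdom c) \<and> open (cmap c ` cdom c) \<and>
     homeomorphism (cdom c) (cmap c ` cdom c) (cmap c) (cinv c)"

definition smooth_transition ::
    "('m, 'e::euclidean_space) chart \<Rightarrow> ('m, 'e) chart \<Rightarrow> bool" where
  "smooth_transition c c' \<longleftrightarrow>
     smooth_on (cmap c ` (cdom c \<inter> cdom c')) (\<lambda>y. cmap c' (cinv c y))"

definition carrier :: "('m, 'e) chart set \<Rightarrow> 'm set" where
  "carrier A = (\<Union>c\<in>A. cdom c)"

definition charts_at :: "('m, 'e) chart set \<Rightarrow> 'm \<Rightarrow> ('m, 'e) chart set" where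
  "charts_at A x = {c \<in> A. x \<in> cdom c}"

text \<open>
  A smooth manifold is given by a maximal smooth atlas \<open>A\<close>; its underlying space is the open
  subset \<open>carrier A\<close> of a Hausdorff second countable space.
\<close>

definition smooth_manifold ::
    "('m::{t2_space, second_countable_topology}, 'e::euclidean_space) chart set \<Rightarrow> bool" where
  "smooth_manifold A \<longleftrightarrow>
     (\<forall>c\<in>A. is_chart c) \<and>
     (\<forall>c\<in>A. \<forall>c'\<in>A. smooth_transition c c') \<and>
     (\<forall>c. is_chart c \<and> cdom c \<subseteq> carrier A \<and>
          (\<forall>c'\<in>A. smooth_transition c c' \<and> smooth_transition c' c) \<longrightarrow> c \<in> A)"

text \<open>Nullity of a set is tested in charts, for Lebesgue measure on the model space.\<close>

definition almost_everywhere ::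
    "('m, 'e::euclidean_space) chart set \<Rightarrow> ('m \<Rightarrow> bool) \<Rightarrow> bool" where
  "almost_everywhere A P \<longleftrightarrow> (\<forall>c\<in>A. negligible (cmap c ` {x \<in> cdom c. \<not> P x}))"

subsection \<open>Functions, vector fields and tensor fields\<close>

text \<open>
  A tangent vector at \<open>x\<close> is the family of its coordinate vectors in the charts around \<open>x\<close>.
  A tensor in \<open>\<otimes>\<^sup>h T M \<otimes> \<otimes>\<^sup>k T\<^sup>* M\<close> at \<open>x\<close> is a multilinear form in \<open>h\<close> covectors and \<open>k\<close> vectors,
  again given as a family over the charts around \<open>x\<close>; the two list arguments hold the
  coordinates of the covectors (as vectors of the model space, acting by the inner product)
  and of the vectors. Values at charts not around \<open>x\<close>, and at lists of other lengths, are
  irrelevant.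
\<close>

type_synonym ('m, 'e) vfield = "'m \<Rightarrow> ('m, 'e) chart \<Rightarrow> 'e"
type_synonym ('m, 'e) tfield = "'m \<Rightarrow> ('m, 'e) chart \<Rightarrow> 'e list \<Rightarrow> 'e list \<Rightarrow> real"

text \<open>The tangent map of \<open>f\<close> at \<open>x\<close>, in charts \<open>c\<close> around \<open>x\<close> and \<open>c'\<close> around \<open>f x\<close>.\<close>

definition tangent_map ::
    "('m, 'e::euclidean_space) chart \<Rightarrow> ('m, 'e) chart \<Rightarrow> ('m \<Rightarrow> 'm) \<Rightarrow> 'm \<Rightarrow> 'e \<Rightarrow> 'e" where
  "tangent_map c c' f x =
     frechet_derivative (\<lambda>y. cmap c' (f (cinv c y))) (at (cmap c x))"

definition vfield_preserved ::
    "('m, 'e::euclidean_space) chart set \<Rightarrow> 'm set \<Rightarrow> ('m \<Rightarrow> 'm) \<Rightarrow> ('m, 'e) vfield \<Rightarrow> bool" where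
  "vfield_preserved A S f X \<longleftrightarrow>
     (\<forall>x\<in>S. \<forall>c\<in>charts_at A x. \<forall>c'\<in>charts_at A (f x).
        X (f x) c' = tangent_map c c' f x (X x c))"

text \<open>Since \<open>adjoint D\<close> is the pullback of covectors along \<open>D\<close>, this says that \<open>f\<close> maps
  \<open>G\<close> at \<open>x\<close> to \<open>G\<close> at \<open>f x\<close>.\<close>

definition tfield_preserved ::
    "('m, 'e::euclidean_space) chart set \<Rightarrow> nat \<Rightarrow> nat \<Rightarrow> 'm set \<Rightarrow> ('m \<Rightarrow> 'm) \<Rightarrow>
     ('m, 'e) tfield \<Rightarrow> bool" where
  "tfield_preserved A h k S f G \<longleftrightarrow>
     (\<forall>x\<in>S. \<forall>c\<in>charts_at A x. \<forall>c'\<in>charts_at A (f x). \<forall>\<beta> v.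
        length \<beta> = h \<and> length v = k \<longrightarrow>
        G x c (map (adjoint (tangent_map c c' f x)) \<beta>) v =
        G (f x) c' \<beta> (map (tangent_map c c' f x) v))"

definition smooth_function ::
    "('m, 'e::euclidean_space) chart set \<Rightarrow> ('m \<Rightarrow> real) \<Rightarrow> bool" where
  "smooth_function A F \<longleftrightarrow> (\<forall>c\<in>A. smooth_on (cmap c ` cdom c) (\<lambda>y. F (cinv c y)))"

text \<open>Preservation by \<open>id\<close> is the transformation law under change of charts.\<close>

definition vector_field ::
    "('m, 'e::euclidean_space) chart set \<Rightarrow> ('m, 'e) vfield \<Rightarrow> bool" where
  "vector_field A X \<longleftrightarrow>
     vfield_preserved A (carrier A) id X \<and>
     (\<forall>c\<in>A. smooth_on (cmap c ` cdom c) (\<lambda>y. X (cinv c y) c))"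

definition tensor_field ::
    "('m, 'e::euclidean_space) chart set \<Rightarrow> nat \<Rightarrow> nat \<Rightarrow> ('m, 'e) tfield \<Rightarrow> bool" where
  "tensor_field A h k G \<longleftrightarrow>
     (\<forall>x\<in>carrier A. \<forall>c\<in>charts_at A x. \<forall>\<alpha> v. length \<alpha> = h \<and> length v = k \<longrightarrow>
        (\<forall>r<h. linear (\<lambda>a. G x c (\<alpha>[r := a]) v)) \<and>
        (\<forall>s<k. linear (\<lambda>u. G x c \<alpha> (v[s := u])))) \<and>
     tfield_preserved A h k (carrier A) id G \<and>
     (\<forall>c\<in>A. \<forall>\<alpha> v. length \<alpha> = h \<and> length v = k \<longrightarrow>
        smooth_on (cmap c ` cdom c) (\<lambda>y. G (cinv c y) c \<alpha> v))"

definition vfield_deriv ::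
    "('m, 'e::euclidean_space) vfield \<Rightarrow> 'm \<Rightarrow> ('m, 'e) chart \<Rightarrow> 'e \<Rightarrow> 'e" where
  "vfield_deriv X x c = frechet_derivative (\<lambda>y. X (cinv c y) c) (at (cmap c x))"

definition differential ::
    "('m \<Rightarrow> real) \<Rightarrow> 'm \<Rightarrow> ('m, 'e::euclidean_space) chart \<Rightarrow> 'e \<Rightarrow> real" where
  "differential F x c = frechet_derivative (\<lambda>y. F (cinv c y)) (at (cmap c x))"

definition lie_bracket ::
    "('m, 'e::euclidean_space) vfield \<Rightarrow> ('m, 'e) vfield \<Rightarrow> ('m, 'e) vfield" where
  "lie_bracket X Y x c = vfield_deriv Y x c (X x c) - vfield_deriv X x c (Y x c)"

text \<open>
  The coordinate formula
  \<open>X\<^sup>l \<partial>\<^sub>l G\<^sup>i\<^sup>\<dots>\<^sub>j\<^sub>\<dots> - \<Sum> (\<partial>\<^sub>l X\<^sup>i) G\<^sup>l\<^sup>\<dots>\<^sub>j\<^sub>\<dots> + \<Sum> (\<partial>\<^sub>j X\<^sup>l) G\<^sup>i\<^sup>\<dots>\<^sub>l\<^sub>\<dots>\<close>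
  evaluated on covectors \<open>\<alpha>\<close> and vectors \<open>v\<close> with constant coordinates.
\<close>

definition lie_deriv ::
    "('m, 'e::euclidean_space) vfield \<Rightarrow> ('m, 'e) tfield \<Rightarrow> ('m, 'e) tfield" where
  "lie_deriv X G x c \<alpha> v =
     frechet_derivative (\<lambda>y. G (cinv c y) c \<alpha> v) (at (cmap c x)) (X x c)
     - (\<Sum>r<length \<alpha>. G x c (\<alpha>[r := adjoint (vfield_deriv X x c) (\<alpha> ! r)]) v)
     + (\<Sum>s<length v. G x c \<alpha> (v[s := vfield_deriv X x c (v ! s)]))"

definition invariant_under_vfield ::
    "('m, 'e::euclidean_space) chart set \<Rightarrow> nat \<Rightarrow> nat \<Rightarrow> ('m, 'e) vfield \<Rightarrow>
     ('m, 'e) tfield \<Rightarrow> bool" where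
  "invariant_under_vfield A h k X G \<longleftrightarrow>
     (\<forall>x\<in>carrier A. \<forall>c\<in>charts_at A x. \<forall>\<alpha> v.
        length \<alpha> = h \<and> length v = k \<longrightarrow> lie_deriv X G x c \<alpha> v = 0)"

text \<open>The orbit consists of all points on integral curves through \<open>x\<close>.\<close>

definition integral_curve ::
    "('m::topological_space, 'e::euclidean_space) chart set \<Rightarrow> ('m, 'e) vfield \<Rightarrow> real set \<Rightarrow>
     (real \<Rightarrow> 'm) \<Rightarrow> bool" where
  "integral_curve A X I \<gamma> \<longleftrightarrow>
     continuous_on I \<gamma> \<and> \<gamma> ` I \<subseteq> carrier A \<and>
     (\<forall>t\<in>I. \<forall>c\<in>charts_at A (\<gamma> t).
        ((\<lambda>u. cmap c (\<gamma> u)) has_vector_derivative X (\<gamma> t) c) (at t))"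

definition orbit ::
    "('m::topological_space, 'e::euclidean_space) chart set \<Rightarrow> ('m, 'e) vfield \<Rightarrow> 'm \<Rightarrow>
     'm set" where
  "orbit A X x =
     {\<gamma> t | \<gamma> t a b. 0 \<in> {a<..<b} \<and> t \<in> {a<..<b} \<and>
        integral_curve A X {a<..<b} \<gamma> \<and> \<gamma> 0 = x}"

subsection \<open>Integrable systems\<close>

text \<open>
  The exterior product \<open>\<omega>\<^sub>0 \<and> \<dots> \<and> \<omega>\<^bsub>n-1\<^esub>\<close> of linear forms, as an alternating form.
  Indices of vector fields, functions and coordinates start at \<open>0\<close> throughout.
\<close>

definition wedge :: "nat \<Rightarrow> (nat \<Rightarrow> 'v \<Rightarrow> real) \<Rightarrow> (nat \<Rightarrow> 'v) \<Rightarrow> real" where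
  "wedge n \<omega> v =
     (\<Sum>\<sigma> | \<sigma> permutes {..<n}. of_int (sign \<sigma>) * (\<Prod>i<n. \<omega> i (v (\<sigma> i))))"

definition regular_at ::
    "('m, 'e::euclidean_space) chart set \<Rightarrow> nat \<Rightarrow> nat \<Rightarrow> (nat \<Rightarrow> ('m, 'e) vfield) \<Rightarrow>
     (nat \<Rightarrow> 'm \<Rightarrow> real) \<Rightarrow> 'm \<Rightarrow> bool" where
  "regular_at A p q X F x \<longleftrightarrow>
     (\<forall>c\<in>charts_at A x.
        wedge p (\<lambda>i \<alpha>. X i x c \<bullet> \<alpha>) \<noteq> (\<lambda>_. 0) \<and>
        wedge q (\<lambda>j. differential (F j) x c) \<noteq> (\<lambda>_. 0))"

definition integrable_system ::
    "('m, 'e::euclidean_space) chart set \<Rightarrow> nat \<Rightarrow> nat \<Rightarrow> (nat \<Rightarrow> ('m, 'e) vfield) \<Rightarrow>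
     (nat \<Rightarrow> 'm \<Rightarrow> real) \<Rightarrow> bool" where
  "integrable_system A p q X F \<longleftrightarrow>
     1 \<le> p \<and> DIM('e) = p + q \<and>
     (\<forall>i<p. vector_field A (X i)) \<and>
     (\<forall>j<q. smooth_function A (F j)) \<and>
     (\<forall>x\<in>carrier A. \<forall>c\<in>charts_at A x.
        (\<forall>i<p. \<forall>j<p. lie_bracket (X i) (X j) x c = 0) \<and>
        (\<forall>i<p. \<forall>j<q. differential (F j) x c (X i x c) = 0)) \<and>
     almost_everywhere A (regular_at A p q X F)"

definition level_set ::
    "('m::topological_space, 'e) chart set \<Rightarrow> nat \<Rightarrow> (nat \<Rightarrow> 'm \<Rightarrow> real) \<Rightarrow> 'm set \<Rightarrow> bool" where
  "level_set A q F N \<longleftrightarrow>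
     (\<exists>a. N \<in> components {x \<in> carrier A. \<forall>j<q. F j x = a j})"

definition regular_level_set ::
    "('m::topological_space, 'e::euclidean_space) chart set \<Rightarrow> nat \<Rightarrow> nat \<Rightarrow>
     (nat \<Rightarrow> ('m, 'e) vfield) \<Rightarrow> (nat \<Rightarrow> 'm \<Rightarrow> real) \<Rightarrow> 'm set \<Rightarrow> bool" where
  "regular_level_set A p q X F N \<longleftrightarrow>
     level_set A q F N \<and> (\<forall>x\<in>N. regular_at A p q X F x)"

definition liouville_torus ::
    "('m::topological_space, 'e::euclidean_space) chart set \<Rightarrow> nat \<Rightarrow> nat \<Rightarrow>
     (nat \<Rightarrow> ('m, 'e) vfield) \<Rightarrow> (nat \<Rightarrow> 'm \<Rightarrow> real) \<Rightarrow> 'm set \<Rightarrow> bool" where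
  "liouville_torus A p q X F N \<longleftrightarrow> regular_level_set A p q X F N \<and> compact N"

subsection \<open>Torus actions and Liouville coordinates\<close>

text \<open>An enumeration of the standard basis of the model space (for indices below its dimension).\<close>

definition bvec :: "nat \<Rightarrow> 'e::euclidean_space" where
  "bvec = from_nat_into Basis"

text \<open>
  The torus \<open>\<real>\<^sup>p / \<int>\<^sup>p\<close> is parametrised by \<open>s :: nat \<Rightarrow> real\<close>, of which only \<open>s i mod 1\<close> for
  \<open>i < p\<close> matters; this and freeness are the equivalence in the fourth line below.
  For joint smoothness, the torus parameter is read off from the coordinates of a vector \<open>w\<close>
  of the model space (of dimension at least \<open>p\<close>), i.e. the action is composed with the
  submersion onto the torus.
\<close>

definition free_torus_action ::
    "('m::topological_space, 'e::euclidean_space) chart set \<Rightarrow> nat \<Rightarrow> 'm set \<Rightarrow>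
     ((nat \<Rightarrow> real) \<Rightarrow> 'm \<Rightarrow> 'm) \<Rightarrow> bool" where
  "free_torus_action A p U \<rho> \<longleftrightarrow>
     (\<forall>s. \<forall>x\<in>U. \<rho> s x \<in> U) \<and>
     (\<forall>x\<in>U. \<rho> (\<lambda>_. 0) x = x) \<and>
     (\<forall>s t. \<forall>x\<in>U. \<rho> (\<lambda>i. s i + t i) x = \<rho> s (\<rho> t x)) \<and>
     (\<forall>s t. \<forall>x\<in>U. \<rho> s x = \<rho> t x \<longleftrightarrow> (\<forall>i<p. s i - t i \<in> \<int>)) \<and>
     continuous_on (UNIV \<times> U) (\<lambda>(w :: 'e, x). \<rho> (\<lambda>i. w \<bullet> bvec i) x) \<and>
     (\<forall>c\<in>A. \<forall>c'\<in>A. smooth_on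
        {(w :: 'e, y). y \<in> cmap c ` (cdom c \<inter> U) \<and> \<rho> (\<lambda>i. w \<bullet> bvec i) (cinv c y) \<in> cdom c'}
        (\<lambda>(w, y). cmap c' (\<rho> (\<lambda>i. w \<bullet> bvec i) (cinv c y))))"

definition liouville_torus_action ::
    "('m::topological_space, 'e::euclidean_space) chart set \<Rightarrow> nat \<Rightarrow> nat \<Rightarrow>
     (nat \<Rightarrow> ('m, 'e) vfield) \<Rightarrow> (nat \<Rightarrow> 'm \<Rightarrow> real) \<Rightarrow> 'm set \<Rightarrow>
     ((nat \<Rightarrow> real) \<Rightarrow> 'm \<Rightarrow> 'm) \<Rightarrow> bool" where
  "liouville_torus_action A p q X F U \<rho> \<longleftrightarrow>
     open U \<and> U \<subseteq> carrier A \<and>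
     free_torus_action A p U \<rho> \<and>
     (\<forall>s. \<forall>i<p. vfield_preserved A U (\<rho> s) (X i)) \<and>
     (\<forall>s. \<forall>j<q. \<forall>x\<in>U. F j (\<rho> s x) = F j x) \<and>
     (\<forall>x\<in>U. regular_level_set A p q X F (range (\<lambda>s. \<rho> s x)))"

text \<open>
  The model space is \<open>\<real>\<^sup>p \<times> \<real>\<^sup>q\<close>, with \<open>\<real>\<^sup>p\<close> spanned by the first \<open>p\<close> basis vectors and
  \<open>\<real>\<^sup>q\<close> by the others; \<open>zball p r\<close> is the ball \<open>B\<^sup>q\<close>, which is a point for \<open>q = 0\<close>.
\<close>

definition tvec :: "nat \<Rightarrow> (nat \<Rightarrow> real) \<Rightarrow> 'e::euclidean_space" where
  "tvec p s = (\<Sum>i<p. s i *\<^sub>R bvec i)"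

definition zball :: "nat \<Rightarrow> real \<Rightarrow> 'e::euclidean_space set" where
  "zball p r = {z. (\<forall>i<p. z \<bullet> bvec i = 0) \<and> norm z < r}"

definition cylinder :: "nat \<Rightarrow> real \<Rightarrow> 'e::euclidean_space set" where
  "cylinder p r = {tvec p s + z | s z. z \<in> zball p r}"

definition local_diffeo ::
    "('m, 'e::euclidean_space) chart set \<Rightarrow> 'e set \<Rightarrow> ('e \<Rightarrow> 'm) \<Rightarrow> bool" where
  "local_diffeo A D \<Psi> \<longleftrightarrow>
     (\<forall>w\<in>D. \<exists>W. open W \<and> w \<in> W \<and> W \<subseteq> D \<and> inj_on \<Psi> W \<and> (\<Psi> ` W, inv_into W \<Psi>) \<in> A)"

text \<open>
  A diffeomorphism from \<open>\<real>\<^sup>p / \<int>\<^sup>p \<times> B\<^sup>q\<close> onto \<open>U\<close>, given by its lift \<open>\<Psi>\<close> to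
  \<open>\<real>\<^sup>p \<times> B\<^sup>q\<close>, that turns the action \<open>\<rho>\<close> into the translations of the first factor.
\<close>

definition liouville_coordinates ::
    "('m, 'e::euclidean_space) chart set \<Rightarrow> nat \<Rightarrow> real \<Rightarrow> 'm set \<Rightarrow>
     ((nat \<Rightarrow> real) \<Rightarrow> 'm \<Rightarrow> 'm) \<Rightarrow> ('e \<Rightarrow> 'm) \<Rightarrow> bool" where
  "liouville_coordinates A p r U \<rho> \<Psi> \<longleftrightarrow>
     0 < r \<and>
     local_diffeo A (cylinder p r) \<Psi> \<and>
     \<Psi> ` cylinder p r = U \<and>
     (\<forall>s t. \<forall>z\<in>zball p r. \<forall>z'\<in>zball p r.
        \<Psi> (tvec p s + z) = \<Psi> (tvec p t + z') \<longleftrightarrow> z = z' \<and> (\<forall>i<p. s i - t i \<in> \<int>)) \<and>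
     (\<forall>s t. \<forall>z\<in>zball p r. \<rho> s (\<Psi> (tvec p t + z)) = \<Psi> (tvec p (\<lambda>i. s i + t i) + z))"

text \<open>The torus \<open>\<real>\<^sup>p / \<int>\<^sup>p \<times> {z}\<close>.\<close>

definition torus_at :: "nat \<Rightarrow> ('e::euclidean_space \<Rightarrow> 'm) \<Rightarrow> 'e \<Rightarrow> 'm set" where
  "torus_at p \<Psi> z = range (\<lambda>s. \<Psi> (tvec p s + z))"

end

theory Submission
  imports Defs
begin

text \<open>
  Lift everything along the covering \<open>\<Psi>\<close> to \<open>D = \<real>\<^sup>p \<times> B\<^sup>q\<close>, and write \<open>V\<close> for \<open>\<real>\<^sup>p\<close>, the range of
  \<open>tvec p\<close>. Local inverses of \<open>\<Psi>\<close> are charts, so a vector or tensor field becomes one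
  globally defined coordinate expression on \<open>D\<close>, and the torus action becomes translation by \<open>V\<close>.
  The lift \<open>Y\<close> of \<open>X 0\<close> is invariant under these translations; the lift \<open>g\<close> of \<open>G\<close> is
  periodic, and the claim is that it is invariant under all of them.

  The field \<open>Y\<close> takes values in \<open>V\<close>. Over a point \<open>z\<close> with dense orbits there is an integral
  curve through every point of the torus, since the closure of the empty set is empty. Such a
  curve stays in a joint level set of the \<open>F j\<close>, hence in its component, the torus, and its
  velocity is tangent to the torus. By density this extends to all \<open>z\<close>.

  Let \<open>L\<close> be the derivative of \<open>Y\<close> at a point. It vanishes on \<open>V\<close> by translation invariance and
  maps into \<open>V\<close> by the previous remark, so \<open>L \<circ> L = 0\<close>; moreover it is the same along each straight
  line \<open>t \<mapsto> w + t Y(w)\<close>, which is an integral curve of \<open>Y\<close>. On this line the vanishing of the Lie derivative is a linear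
  differential equation with constant coefficients for \<open>g\<close>, whose right-hand side inserts \<open>L\<close> or
  its adjoint into one argument of the tensor. As \<open>L\<close> squares to zero, the solutions are polynomials
  in \<open>t\<close>; as \<open>g\<close> is periodic, they are bounded. So they are constant
  (\<open>bounded_tensor_flow_constant\<close>), and the components of \<open>g\<close> have zero derivative along \<open>Y\<close> on
  all of \<open>D\<close> (\<open>lift_tfield_derivative_zero\<close>).

  Consequently the components of \<open>g\<close> are constant along integral curves of \<open>X 0\<close>
  (\<open>lift_tfield_const_on_curve\<close>), by continuity they are constant on every torus with dense orbits,
  and by density on every torus. Translation invariance of the components in the lifted charts is
  invariance under the torus action in any charts (\<open>tfield_preserved_of_lift\<close>).
\<close>

section \<open>Linear flows of tensors\<close>

lemma bounded_affine_constant: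
  fixes f :: "real \<Rightarrow> real"
  assumes der: "\<And>t. (f has_real_derivative d) (at t)" and bdd: "bounded (range f)"
  shows "f t = f u"
proof -
  have *: "f t - d * t = f 0" for t
  proof -
    have "\<forall>u. ((\<lambda>t. f t - d * t) has_real_derivative 0) (at u)"
      using der by (auto intro!: derivative_eq_intros)
    from DERIV_isconst_all[OF this, of t 0] show ?thesis by simp
  qed
  obtain B where B: "\<And>t. \<bar>f t\<bar> \<le> B"
    using bdd by (auto simp: bounded_iff)
  have d: "d = 0"
  proof (rule ccontr)
    assume "d \<noteq> 0"
    then have "f ((2 * B + 1) / d) = f 0 + (2 * B + 1)"
      using *[of "(2 * B + 1) / d"] by simp
    then show False using B[of 0] B[of "(2 * B + 1) / d"] by linarith
  qed
  show "f t = f u" using *[of t] *[of u] d by simp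
qed

text \<open>
  \<open>L\<close> acts on the vector arguments and \<open>M\<close> on the covector arguments. Since both square to zero,
  differentiating in \<open>t\<close> replaces a component by components with fewer arguments outside the
  kernels, those with a zero argument vanishing. By induction on that number the derivative is
  constant, and a bounded affine function is constant.
\<close>

lemma bounded_tensor_flow_constant:
  fixes g :: "real \<Rightarrow> 'a::zero list \<Rightarrow> 'a list \<Rightarrow> real" and L M :: "'a \<Rightarrow> 'a"
  assumes LL: "\<And>x. L (L x) = 0" and MM: "\<And>x. M (M x) = 0"
    and zero1: "\<And>t \<alpha> v i. length \<alpha> = h \<Longrightarrow> length v = k \<Longrightarrow> i < h \<Longrightarrow> g t (\<alpha>[i := 0]) v = 0"
    and zero2: "\<And>t \<alpha> v i. length \<alpha> = h \<Longrightarrow> length v = k \<Longrightarrow> i < k \<Longrightarrow> g t \<alpha> (v[i := 0]) = 0"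
    and der: "\<And>t \<alpha> v. length \<alpha> = h \<Longrightarrow> length v = k \<Longrightarrow>
       ((\<lambda>t. g t \<alpha> v) has_real_derivative
          (\<Sum>i<h. g t (\<alpha>[i := M (\<alpha> ! i)]) v) - (\<Sum>i<k. g t \<alpha> (v[i := L (v ! i)]))) (at t)"
    and bdd: "\<And>\<alpha> v. length \<alpha> = h \<Longrightarrow> length v = k \<Longrightarrow> bounded (range (\<lambda>t. g t \<alpha> v))"
    and "length \<alpha> = h" "length v = k"
  shows "g t \<alpha> v = g u \<alpha> v"
  using \<open>length \<alpha> = h\<close> \<open>length v = k\<close>
proof (induction "card {i. i < h \<and> M (\<alpha> ! i) \<noteq> 0} + card {i. i < k \<and> L (v ! i) \<noteq> 0}"
    arbitrary: \<alpha> v t u rule: less_induct)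
  case less
  note len = \<open>length \<alpha> = h\<close> \<open>length v = k\<close>
  have 1: "g t (\<alpha>[i := M (\<alpha> ! i)]) v = g 0 (\<alpha>[i := M (\<alpha> ! i)]) v" if "i < h" for i t
  proof (cases "M (\<alpha> ! i) = 0")
    case True
    then show ?thesis using zero1 len that by simp
  next
    case False
    have "{j. j < h \<and> M (\<alpha>[i := M (\<alpha> ! i)] ! j) \<noteq> 0} \<subset> {j. j < h \<and> M (\<alpha> ! j) \<noteq> 0}"
      using that False len MM by (auto simp: nth_list_update split: if_splits)
    then have "card {j. j < h \<and> M (\<alpha>[i := M (\<alpha> ! i)] ! j) \<noteq> 0} < card {j. j < h \<and> M (\<alpha> ! j) \<noteq> 0}"
      by (intro psubset_card_mono) auto
    then show ?thesis using less.hyps len by simp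
  qed
  have 2: "g t \<alpha> (v[i := L (v ! i)]) = g 0 \<alpha> (v[i := L (v ! i)])" if "i < k" for i t
  proof (cases "L (v ! i) = 0")
    case True
    then show ?thesis using zero2 len that by simp
  next
    case False
    have "{j. j < k \<and> L (v[i := L (v ! i)] ! j) \<noteq> 0} \<subset> {j. j < k \<and> L (v ! j) \<noteq> 0}"
      using that False len LL by (auto simp: nth_list_update split: if_splits)
    then have "card {j. j < k \<and> L (v[i := L (v ! i)] ! j) \<noteq> 0} < card {j. j < k \<and> L (v ! j) \<noteq> 0}"
      by (intro psubset_card_mono) auto
    then show ?thesis using less.hyps len by simp
  qed
  have "((\<lambda>t. g t \<alpha> v) has_real_derivative
      (\<Sum>i<h. g 0 (\<alpha>[i := M (\<alpha> ! i)]) v) - (\<Sum>i<k. g 0 \<alpha> (v[i := L (v ! i)]))) (at t)" for t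
  proof -
    have "(\<Sum>i<h. g t (\<alpha>[i := M (\<alpha> ! i)]) v) = (\<Sum>i<h. g 0 (\<alpha>[i := M (\<alpha> ! i)]) v)"
      "(\<Sum>i<k. g t \<alpha> (v[i := L (v ! i)])) = (\<Sum>i<k. g 0 \<alpha> (v[i := L (v ! i)]))"
      by (intro sum.cong refl 1 2; simp)+
    then show ?thesis using der[OF len, of t] by simp
  qed
  from bounded_affine_constant[OF this bdd[OF len]] show ?case .
qed

section \<open>Calculus\<close>

lemma smooth_on_imp_differentiable:
  assumes "smooth_on S f" "x \<in> S"
  shows "f differentiable (at x)"
  using assms Ck_on.simps(2)[of 0 S f] unfolding smooth_on_def by blast

lemma isCont_imp_tendsto_nhds: "isCont f a \<Longrightarrow> (f \<longlongrightarrow> f a) (nhds a)"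
  by (simp add: isCont_def tendsto_at_iff_tendsto_nhds)

text \<open>
  Both extensions from the tori with dense orbits to all tori have this form: a subspace and
  the set \<open>{0}\<close> are closed.
\<close>

lemma continuous_on_dense_closed:
  assumes "continuous_on S f" "S \<subseteq> closure T" "T \<subseteq> S" "closed C" "\<And>x. x \<in> T \<Longrightarrow> f x \<in> C" "x \<in> S"
  shows "f x \<in> C"
proof -
  obtain K where K: "closed K" "S \<inter> f -` C = S \<inter> K"
    using continuous_closedin_preimage[OF assms(1,4)] by (auto simp: closedin_closed)
  then have "T \<subseteq> K" using assms(3,5) by auto
  then have "closure T \<subseteq> K" using K(1) by (rule closure_minimal)
  then show ?thesis using assms(2,6) K(2) by auto
qed

lemma has_vector_derivative_in_subspace:
  fixes f :: "real \<Rightarrow> 'e::euclidean_space"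
  assumes der: "(f has_vector_derivative d) (at t)" and V: "subspace V"
    and ev: "\<forall>\<^sub>F u in at t. f u - f t \<in> V"
  shows "d \<in> V"
proof (rule Lim_in_closed_set)
  show "closed V" using V by (rule closed_subspace)
  show "((\<lambda>u. (f u - f t) /\<^sub>R (u - t)) \<longlongrightarrow> d) (at t)"
  proof -
    have "((\<lambda>u. norm (f u - f t - (u - t) *\<^sub>R d) / norm (u - t)) \<longlongrightarrow> 0) (at t)"
      using der by (simp add: has_vector_derivative_def has_derivative_iff_norm)
    moreover have "\<forall>\<^sub>F u in at t. norm (f u - f t - (u - t) *\<^sub>R d) / norm (u - t)
        = norm ((f u - f t) /\<^sub>R (u - t) - d)"
      using eventually_neq_at_within[of t]
    proof eventually_elim
      fix u assume "u \<noteq> t"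
      then have "(f u - f t) /\<^sub>R (u - t) - d = (f u - f t - (u - t) *\<^sub>R d) /\<^sub>R (u - t)"
        by (simp add: scaleR_diff_right)
      then show "norm (f u - f t - (u - t) *\<^sub>R d) / norm (u - t)
          = norm ((f u - f t) /\<^sub>R (u - t) - d)"
        by (simp add: divide_inverse mult.commute)
    qed
    ultimately have "((\<lambda>u. norm ((f u - f t) /\<^sub>R (u - t) - d)) \<longlongrightarrow> 0) (at t)"
      by (rule Lim_transform_eventually)
    then show ?thesis by (simp add: tendsto_norm_zero_iff LIM_zero_iff)
  qed
  show "\<forall>\<^sub>F u in at t. (f u - f t) /\<^sub>R (u - t) \<in> V"
    using ev by eventually_elim (simp add: V subspace_scale)
qed simp

lemma frechet_derivative_along_line:
  fixes f :: "'a::real_normed_vector \<Rightarrow> 'b::real_normed_vector"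
  assumes der: "f differentiable (at (x + t *\<^sub>R v))"
  shows "((\<lambda>t::real. f (x + t *\<^sub>R v)) has_vector_derivative
    frechet_derivative f (at (x + t *\<^sub>R v)) v) (at t)"
proof -
  have l: "((\<lambda>t. x + t *\<^sub>R v) has_vector_derivative v) (at t)"
    by (auto intro!: derivative_eq_intros)
  have "(f has_derivative frechet_derivative f (at (x + t *\<^sub>R v))) (at (x + t *\<^sub>R v))"
    using der frechet_derivative_works by blast
  from diff_chain_at[OF l[unfolded has_vector_derivative_def] this] show ?thesis
    using linear_scale[OF linear_frechet_derivative[OF der]]
    by (simp add: has_vector_derivative_def o_def)
qed

lemma frechet_derivative_in_subspace:
  fixes f :: "'a::euclidean_space \<Rightarrow> 'e::euclidean_space"
  assumes der: "f differentiable (at x)" and V: "subspace V"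
    and ev: "\<forall>\<^sub>F y in nhds x. f y - f x \<in> V"
  shows "frechet_derivative f (at x) v \<in> V"
proof (rule has_vector_derivative_in_subspace[OF _ V])
  show "((\<lambda>t::real. f (x + t *\<^sub>R v)) has_vector_derivative frechet_derivative f (at x) v) (at 0)"
    using frechet_derivative_along_line[of f x 0 v] der by simp
  have "((\<lambda>t::real. x + t *\<^sub>R v) \<longlongrightarrow> x) (at 0)"
    by (auto intro!: tendsto_eq_intros)
  from eventually_compose_filterlim[OF ev this]
  show "\<forall>\<^sub>F t::real in at 0. f (x + t *\<^sub>R v) - f (x + 0 *\<^sub>R v) \<in> V" by simp
qed

lemma has_derivative_cong_nhds:
  assumes "\<forall>\<^sub>F u in nhds y. f u = g u"
  shows "(f has_derivative f') (at y) \<longleftrightarrow> (g has_derivative f') (at y)"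
proof -
  have "f y = g y" "\<forall>\<^sub>F u in at y. f u = g u"
    using assms eventually_nhds_x_imp_x by (auto simp: eventually_at_filter elim: eventually_mono)
  then show ?thesis
    using has_derivative_transform_eventually[of f f' y UNIV g]
      has_derivative_transform_eventually[of g f' y UNIV f]
    by (auto simp: eq_commute)
qed

lemma frechet_derivative_cong_nhds:
  assumes "\<forall>\<^sub>F u in nhds y. f u = g u"
  shows "f differentiable (at y) \<longleftrightarrow> g differentiable (at y)"
    "frechet_derivative f (at y) = frechet_derivative g (at y)"
  unfolding differentiable_def frechet_derivative_def has_derivative_cong_nhds[OF assms] by simp_all

section \<open>Charts\<close>

lemma smooth_manifold_chart:
  assumes "smooth_manifold A" "c \<in> A" "x \<in> cdom c"
  shows "open (cdom c)" "cinv c (cmap c x) = x" "isCont (cinv c) (cmap c x)"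
    "open (cmap c ` cdom c)"
proof -
  have c: "is_chart c" using assms unfolding smooth_manifold_def by blast
  then show "open (cdom c)" "open (cmap c ` cdom c)" unfolding is_chart_def by auto
  have h: "homeomorphism (cdom c) (cmap c ` cdom c) (cmap c) (cinv c)"
    using c unfolding is_chart_def by auto
  then show "cinv c (cmap c x) = x" using assms(3) by (simp add: homeomorphism_apply1)
  show "isCont (cinv c) (cmap c x)"
    using h assms(3) \<open>open (cmap c ` cdom c)\<close>
    by (meson continuous_on_eq_continuous_at homeomorphism_cont2 imageI)
qed

lemma transition_differentiable:
  assumes "smooth_manifold A" "c \<in> charts_at A x" "c' \<in> charts_at A x"
  shows "(\<lambda>y. cmap c' (cinv c y)) differentiable (at (cmap c x))"
proof (rule smooth_on_imp_differentiable)
  show "smooth_on (cmap c ` (cdom c \<inter> cdom c')) (\<lambda>y. cmap c' (cinv c y))"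
    using assms unfolding smooth_manifold_def smooth_transition_def charts_at_def by blast
  show "cmap c x \<in> cmap c ` (cdom c \<inter> cdom c')"
    using assms by (auto simp: charts_at_def)
qed

lemma vfield_preservedD:
  "vfield_preserved A S f X \<Longrightarrow> x \<in> S \<Longrightarrow> c \<in> charts_at A x \<Longrightarrow> c' \<in> charts_at A (f x) \<Longrightarrow>
   X (f x) c' = tangent_map c c' f x (X x c)"
  by (simp add: vfield_preserved_def)

lemma tfield_preservedD:
  "tfield_preserved A h k S f G \<Longrightarrow> x \<in> S \<Longrightarrow> c \<in> charts_at A x \<Longrightarrow> c' \<in> charts_at A (f x) \<Longrightarrow>
   length \<beta> = h \<Longrightarrow> length v = k \<Longrightarrow>
   G x c (map (adjoint (tangent_map c c' f x)) \<beta>) v = G (f x) c' \<beta> (map (tangent_map c c' f x) v)"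
  by (simp add: tfield_preserved_def)

text \<open>
  This reduces the derivative of a function along an integral curve to coordinates; it is used both
  for the first integrals and for the components of the tensor field.
\<close>

lemma integral_curve_derivative:
  fixes f :: "'m::{t2_space, second_countable_topology} \<Rightarrow> real"
  assumes A: "smooth_manifold A" and \<gamma>: "integral_curve A X I \<gamma>" and I: "open I" and t: "t \<in> I"
    and c: "c \<in> charts_at A (\<gamma> t)"
    and f: "(\<lambda>y. f (cinv c y)) differentiable (at (cmap c (\<gamma> t)))"
  shows "((\<lambda>u. f (\<gamma> u)) has_real_derivative
     frechet_derivative (\<lambda>y. f (cinv c y)) (at (cmap c (\<gamma> t))) (X (\<gamma> t) c)) (at t)"
proof -
  let ?D = "frechet_derivative (\<lambda>y. f (cinv c y)) (at (cmap c (\<gamma> t)))"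
  have cA: "c \<in> A" "\<gamma> t \<in> cdom c" using c by (auto simp: charts_at_def)
  have "((\<lambda>u. cmap c (\<gamma> u)) has_vector_derivative X (\<gamma> t) c) (at t)"
    using \<gamma> t c unfolding integral_curve_def by blast
  moreover have "((\<lambda>y. f (cinv c y)) has_derivative ?D) (at (cmap c (\<gamma> t)))"
    using f frechet_derivative_works by blast
  ultimately have "((\<lambda>y. f (cinv c y)) \<circ> (\<lambda>u. cmap c (\<gamma> u)) has_derivative
      ?D \<circ> (\<lambda>s. s *\<^sub>R X (\<gamma> t) c)) (at t)"
    unfolding has_vector_derivative_def by (rule diff_chain_at)
  then have "((\<lambda>u. f (cinv c (cmap c (\<gamma> u)))) has_derivative (\<lambda>s. ?D (s *\<^sub>R X (\<gamma> t) c))) (at t)"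
    by (simp add: o_def)
  moreover have "(\<lambda>s. ?D (s *\<^sub>R X (\<gamma> t) c)) = (*) (?D (X (\<gamma> t) c))"
    using linear_scale[OF linear_frechet_derivative[OF f]] by (auto simp: mult.commute)
  ultimately have d: "((\<lambda>u. f (cinv c (cmap c (\<gamma> u)))) has_real_derivative ?D (X (\<gamma> t) c)) (at t)"
    by (simp add: has_field_derivative_def)
  have "isCont \<gamma> t"
    using \<gamma> I t unfolding integral_curve_def by (simp add: continuous_on_eq_continuous_at)
  then have "\<forall>\<^sub>F u in nhds t. \<gamma> u \<in> cdom c"
    using smooth_manifold_chart(1)[OF A cA] cA(2)
    by (intro topological_tendstoD[OF isCont_imp_tendsto_nhds])
  then have ev: "\<forall>\<^sub>F u in nhds t. f (cinv c (cmap c (\<gamma> u))) = f (\<gamma> u)"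
    by eventually_elim (simp add: smooth_manifold_chart(2)[OF A cA(1)])
  then show ?thesis using d by (simp add: DERIV_cong_ev[OF refl ev refl])
qed

section \<open>The lift of a torus neighbourhood\<close>

lemma tvec_add: "tvec p (\<lambda>i. s i + t i) = tvec p s + tvec p t"
  by (simp add: tvec_def scaleR_left_distrib sum.distrib)

lemma tvec_scale: "tvec p (\<lambda>i. a * s i) = a *\<^sub>R tvec p s"
  by (simp add: tvec_def scaleR_sum_right)

lemma tvec_zero: "tvec p (\<lambda>_. 0) = 0"
  by (simp add: tvec_def)

lemma subspace_tvec: "subspace (range (tvec p))"
  unfolding subspace_def
proof (intro conjI ballI allI)
  show "0 \<in> range (tvec p)" by (rule range_eqI[of _ _ "\<lambda>_. 0"]) (simp add: tvec_zero)
  fix x y :: 'a and a :: real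
  assume "x \<in> range (tvec p)"
  then obtain s where s: "x = tvec p s" by blast
  show "a *\<^sub>R x \<in> range (tvec p)"
    by (rule range_eqI[of _ _ "\<lambda>i. a * s i"]) (simp only: tvec_scale s)
  assume "y \<in> range (tvec p)"
  then obtain t where t: "y = tvec p t" by blast
  show "x + y \<in> range (tvec p)"
    by (rule range_eqI[of _ _ "\<lambda>i. s i + t i"]) (simp only: tvec_add s t)
qed

text \<open>
  Local inverses of \<open>\<Psi>\<close> cover the torus neighbourhood by charts whose transition maps are
  locally translations. In these charts fields have well-defined coordinate expressions on the whole cylinder.
\<close>

locale torus_cylinder =
  fixes A :: "('m::{t2_space, second_countable_topology}, 'e::euclidean_space) chart set"
    and p :: nat and r :: real and U :: "'m set"
    and \<rho> :: "(nat \<Rightarrow> real) \<Rightarrow> 'm \<Rightarrow> 'm" and \<Psi> :: "'e \<Rightarrow> 'm"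
  assumes manifold: "smooth_manifold A"
    and coordinates: "liouville_coordinates A p r U \<rho> \<Psi>"
begin

abbreviation D :: "'e set" where "D \<equiv> cylinder p r"
abbreviation B :: "'e set" where "B \<equiv> zball p r"

lemma in_D: "z \<in> B \<Longrightarrow> tvec p s + z \<in> D"
  by (auto simp: cylinder_def)

lemma D_translate: "w \<in> D \<Longrightarrow> w + tvec p s \<in> D"
proof -
  assume "w \<in> D"
  then obtain t z where "w = tvec p t + z" "z \<in> B" by (auto simp: cylinder_def)
  then have "w + tvec p s = tvec p (\<lambda>i. t i + s i) + z" by (simp add: tvec_add)
  then show ?thesis using in_D[OF \<open>z \<in> B\<close>] by simp
qed

lemma image_D: "\<Psi> ` D = U"
  using coordinates by (simp add: liouville_coordinates_def)

lemma \<Psi>_eq_iff: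
  "z \<in> B \<Longrightarrow> z' \<in> B \<Longrightarrow>
   \<Psi> (tvec p s + z) = \<Psi> (tvec p t + z') \<longleftrightarrow> z = z' \<and> (\<forall>i<p. s i - t i \<in> \<int>)"
  using coordinates by (simp add: liouville_coordinates_def)

lemma \<Psi>_translate: "w \<in> D \<Longrightarrow> \<Psi> (w + tvec p s) = \<rho> s (\<Psi> w)"
proof -
  assume "w \<in> D"
  then obtain t z where w: "w = tvec p t + z" "z \<in> B" by (auto simp: cylinder_def)
  then have "w + tvec p s = tvec p (\<lambda>i. s i + t i) + z" by (simp add: tvec_add)
  moreover have "\<rho> s (\<Psi> (tvec p t + z)) = \<Psi> (tvec p (\<lambda>i. s i + t i) + z)"
    using coordinates w(2) unfolding liouville_coordinates_def by blast
  ultimately show ?thesis using w(1) by metis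
qed

lemma \<Psi>_periodic: "w \<in> D \<Longrightarrow> (\<And>i. i < p \<Longrightarrow> s i \<in> \<int>) \<Longrightarrow> \<Psi> (w + tvec p s) = \<Psi> w"
proof -
  assume "w \<in> D" and s: "\<And>i. i < p \<Longrightarrow> s i \<in> \<int>"
  then obtain t z where w: "w = tvec p t + z" "z \<in> B" by (auto simp: cylinder_def)
  then have "w + tvec p s = tvec p (\<lambda>i. t i + s i) + z" by (simp add: tvec_add)
  moreover have "\<Psi> (tvec p (\<lambda>i. t i + s i) + z) = \<Psi> (tvec p t + z)"
    using \<Psi>_eq_iff[OF w(2) w(2), of "\<lambda>i. t i + s i" t] s by simp
  ultimately show ?thesis using w(1) by metis
qed

lemma \<Psi>_eqD:
  assumes "\<Psi> w = \<Psi> w'" "w \<in> D" "w' \<in> D"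
  obtains s where "w' = w + tvec p s" "\<And>i. i < p \<Longrightarrow> s i \<in> \<int>"
proof -
  obtain t z where w: "w = tvec p t + z" "z \<in> B" using assms by (auto simp: cylinder_def)
  obtain t' z' where w': "w' = tvec p t' + z'" "z' \<in> B" using assms by (auto simp: cylinder_def)
  have *: "z' = z" "\<forall>i<p. t' i - t i \<in> \<int>"
    using \<Psi>_eq_iff[OF w'(2) w(2), of t' t] assms(1) w w' by auto
  have "(tvec p t' :: 'e) = tvec p (\<lambda>i. t i + (t' i - t i))" by simp
  also have "\<dots> = tvec p t + tvec p (\<lambda>i. t' i - t i)" by (rule tvec_add)
  finally have "w' = w + tvec p (\<lambda>i. t' i - t i)"
    unfolding w(1) w'(1) *(1) by (simp only: ac_simps)
  then show thesis using that *(2) by blast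
qed

text \<open>
  A sheet is an open set on which \<open>\<Psi>\<close> is invertible with its inverse in the atlas. The choice of a
  sheet around each point is arbitrary, because coordinates do not depend on it
  (\<open>lift_vfield_chart\<close>, \<open>lift_tfield_at\<close>).
\<close>

definition sheet :: "'e set \<Rightarrow> bool" where
  "sheet W \<longleftrightarrow> open W \<and> W \<subseteq> D \<and> inj_on \<Psi> W \<and> (\<Psi> ` W, inv_into W \<Psi>) \<in> A"

definition sheet_at :: "'e \<Rightarrow> 'e set" where
  "sheet_at w = (SOME W. sheet W \<and> w \<in> W)"

definition lift_chart :: "'e \<Rightarrow> ('m, 'e) chart" where
  "lift_chart w = (\<Psi> ` sheet_at w, inv_into (sheet_at w) \<Psi>)"

lemma sheet_at: assumes "w \<in> D" shows "sheet (sheet_at w)" "w \<in> sheet_at w"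
proof -
  have "\<exists>W. sheet W \<and> w \<in> W"
    using coordinates assms unfolding liouville_coordinates_def local_diffeo_def sheet_def by blast
  from someI_ex[OF this] show "sheet (sheet_at w)" "w \<in> sheet_at w"
    by (simp_all add: sheet_at_def)
qed

lemma open_sheet_at: "w \<in> D \<Longrightarrow> open (sheet_at w)"
  and sheet_at_subset: "w \<in> D \<Longrightarrow> sheet_at w \<subseteq> D"
  and lift_chart_in_atlas: "w \<in> D \<Longrightarrow> lift_chart w \<in> A"
  using sheet_at by (auto simp: sheet_def lift_chart_def)

lemma cdom_lift_chart: "cdom (lift_chart w) = \<Psi> ` sheet_at w"
  by (simp add: lift_chart_def)

lemma cmap_lift_chart: "w \<in> D \<Longrightarrow> y \<in> sheet_at w \<Longrightarrow> cmap (lift_chart w) (\<Psi> y) = y"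
  using sheet_at(1)[of w] by (simp add: lift_chart_def sheet_def)

lemma cinv_lift_chart: 
  assumes "w \<in> D" "y \<in> sheet_at w" 
  shows "cinv (lift_chart w) y = \<Psi> y"
  using smooth_manifold_chart(2)[OF manifold lift_chart_in_atlas[OF assms(1)], of "\<Psi> y"]
    cmap_lift_chart[OF assms] cdom_lift_chart[of w] assms by auto

lemma lift_chart_charts_at: "w \<in> D \<Longrightarrow> y \<in> sheet_at w \<Longrightarrow> lift_chart w \<in> charts_at A (\<Psi> y)"
  by (simp add: charts_at_def lift_chart_in_atlas cdom_lift_chart)

lemma cmap_image_lift_chart: "w \<in> D \<Longrightarrow> cmap (lift_chart w) ` cdom (lift_chart w) = sheet_at w"
  by (auto simp: cdom_lift_chart image_image cmap_lift_chart)

lemma \<Psi>_in_carrier: "w \<in> D \<Longrightarrow> \<Psi> w \<in> carrier A"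
  using lift_chart_charts_at[of w w] sheet_at(2)[of w] by (auto simp: carrier_def charts_at_def)

lemma D_open: "open D"
  by (rule openI) (metis open_sheet_at sheet_at(2) sheet_at_subset openE subset_trans)

lemma eventually_sheet: "w \<in> D \<Longrightarrow> y \<in> sheet_at w \<Longrightarrow> \<forall>\<^sub>F u in nhds y. u \<in> sheet_at w"
  by (rule eventually_nhds_in_open) (auto intro: open_sheet_at)

text \<open>
  Read in two sheets, a map that \<open>\<Psi>\<close> lifts to a translation is that translation, whose derivative is
  the identity. The case \<open>f = id\<close>, \<open>e = 0\<close> gives independence of the sheet, \<open>f = id\<close> with \<open>e\<close>
  a period gives periodicity, and \<open>f = \<rho> s\<close> the translation behaviour.
\<close>

lemma tangent_map_translation:
  assumes w: "w \<in> D" "y \<in> sheet_at w" and w': "w' \<in> D" "y + e \<in> sheet_at w'"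
    and f: "\<And>u. u \<in> D \<Longrightarrow> f (\<Psi> u) = \<Psi> (u + e)"
  shows "tangent_map (lift_chart w) (lift_chart w') f (\<Psi> y) = (\<lambda>v. v)"
proof -
  let ?F = "\<lambda>u. cmap (lift_chart w') (f (cinv (lift_chart w) u))"
  have "((\<lambda>u. u + e) has_derivative (\<lambda>v. v)) (at y)"
    by (auto intro!: derivative_eq_intros)
  moreover have "\<forall>\<^sub>F u in nhds y. u + e = ?F u"
  proof -
    have "((\<lambda>u. u + e) \<longlongrightarrow> y + e) (nhds y)"
      by (intro tendsto_intros filterlim_ident)
    from eventually_compose_filterlim[OF eventually_sheet[OF w'] this] eventually_sheet[OF w]
    show ?thesis
    proof eventually_elim
      case (elim u)
      moreover have "u \<in> D" using elim sheet_at_subset[OF w(1)] by auto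
      ultimately show ?case by (simp add: cinv_lift_chart[OF w(1)] f cmap_lift_chart[OF w'(1)])
    qed
  qed
  ultimately have "(?F has_derivative (\<lambda>v. v)) (at y)"
    using has_derivative_cong_nhds[of "\<lambda>u. u + e" ?F y] by blast
  then show ?thesis
    unfolding tangent_map_def cmap_lift_chart[OF w] by (metis frechet_derivative_at)
qed

definition lift_vfield :: "('m, 'e) vfield \<Rightarrow> 'e \<Rightarrow> 'e" where
  "lift_vfield X w = X (\<Psi> w) (lift_chart w)"

definition lift_tfield :: "('m, 'e) tfield \<Rightarrow> 'e \<Rightarrow> 'e list \<Rightarrow> 'e list \<Rightarrow> real" where
  "lift_tfield G w = G (\<Psi> w) (lift_chart w)"

lemma lift_vfield_chart:
  assumes "vector_field A X" "w \<in> D" "y \<in> sheet_at w"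
  shows "X (\<Psi> y) (lift_chart w) = lift_vfield X y"
proof -
  have y: "y \<in> D" using assms(2,3) sheet_at_subset by auto
  have "tangent_map (lift_chart w) (lift_chart y) id (\<Psi> y) = (\<lambda>v. v)"
    by (rule tangent_map_translation[where e = 0]) (use assms y sheet_at(2) in auto)
  moreover have "X (id (\<Psi> y)) (lift_chart y) = tangent_map (lift_chart w) (lift_chart y) id (\<Psi> y) (X (\<Psi> y) (lift_chart w))"
  proof (rule vfield_preservedD)
    show "vfield_preserved A (carrier A) id X"
      using assms(1) unfolding vector_field_def by blast
  qed (simp_all add: assms y \<Psi>_in_carrier lift_chart_charts_at sheet_at(2))
  ultimately show ?thesis by (simp add: lift_vfield_def)
qed

lemma lift_vfield_eventually:
  assumes "vector_field A X" "w \<in> D" "y \<in> sheet_at w"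
  shows "\<forall>\<^sub>F u in nhds y. X (cinv (lift_chart w) u) (lift_chart w) = lift_vfield X u"
  using eventually_sheet[OF assms(2,3)]
  by eventually_elim (simp add: assms lift_vfield_chart cinv_lift_chart)

lemma lift_vfield_differentiable:
  assumes "vector_field A X" "w \<in> D"
  shows "lift_vfield X differentiable (at w)"
    "vfield_deriv X (\<Psi> w) (lift_chart w) = frechet_derivative (lift_vfield X) (at w)"
proof -
  note w = assms(2) sheet_at(2)[OF assms(2)]
  note ev = lift_vfield_eventually[OF assms(1) w]
  have "smooth_on (cmap (lift_chart w) ` cdom (lift_chart w)) (\<lambda>y. X (cinv (lift_chart w) y) (lift_chart w))"
    using assms(1) lift_chart_in_atlas[OF w(1)] unfolding vector_field_def by blast
  then have "(\<lambda>y. X (cinv (lift_chart w) y) (lift_chart w)) differentiable (at w)"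
    by (rule smooth_on_imp_differentiable) (simp add: cmap_image_lift_chart w)
  then show "lift_vfield X differentiable (at w)"
    using frechet_derivative_cong_nhds(1)[OF ev] by simp
  show "vfield_deriv X (\<Psi> w) (lift_chart w) = frechet_derivative (lift_vfield X) (at w)"
    using frechet_derivative_cong_nhds(2)[OF ev] by (simp add: vfield_deriv_def cmap_lift_chart w)
qed

lemma lift_vfield_translate:
  assumes "vfield_preserved A U (\<rho> s) X" "w \<in> D"
  shows "lift_vfield X (w + tvec p s) = lift_vfield X w"
proof -
  let ?w = "w + tvec p s"
  have w': "?w \<in> D" using assms(2) by (rule D_translate)
  have "tangent_map (lift_chart w) (lift_chart ?w) (\<rho> s) (\<Psi> w) = (\<lambda>v. v)"
    by (rule tangent_map_translation[where e = "tvec p s"])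
      (use assms w' sheet_at(2) \<Psi>_translate in auto)
  moreover have "X (\<rho> s (\<Psi> w)) (lift_chart ?w) = tangent_map (lift_chart w) (lift_chart ?w) (\<rho> s) (\<Psi> w) (X (\<Psi> w) (lift_chart w))"
    by (rule vfield_preservedD[OF assms(1)])
      (use assms w' lift_chart_charts_at sheet_at(2) \<Psi>_translate[OF assms(2), of s, symmetric] image_D in auto)
  ultimately show ?thesis by (simp add: lift_vfield_def \<Psi>_translate[OF assms(2)])
qed

text \<open>
  The two points \<open>y\<close> and \<open>y + tvec p s\<close> have the same image, so this compares two sheets
  above it that may differ by a period of the lattice.
\<close>

lemma lift_tfield_chart:
  assumes "tensor_field A h k G" "w \<in> D" "y \<in> sheet_at w" "y + tvec p s \<in> sheet_at w'" "w' \<in> D"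
    and s: "\<And>i. i < p \<Longrightarrow> s i \<in> \<int>" and len: "length \<alpha> = h" "length v = k"
  shows "G (\<Psi> y) (lift_chart w) \<alpha> v = G (\<Psi> y) (lift_chart w') \<alpha> v"
proof -
  have y: "y \<in> D" using assms(2,3) sheet_at_subset by auto
  have T: "tangent_map (lift_chart w) (lift_chart w') id (\<Psi> y) = (\<lambda>v. v)"
    by (rule tangent_map_translation[where e = "tvec p s"]) (use assms y \<Psi>_periodic in auto)
  have c': "lift_chart w' \<in> charts_at A (id (\<Psi> y))"
    using lift_chart_charts_at[OF assms(5,4)] \<Psi>_periodic[OF y s] by simp
  have "tfield_preserved A h k (carrier A) id G"
    using assms(1) unfolding tensor_field_def by blast
  note tfield_preservedD[OF this \<Psi>_in_carrier[OF y] lift_chart_charts_at[OF assms(2,3)] c' len]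
  from this[unfolded T] have "G (\<Psi> y) (lift_chart w) (map (adjoint (\<lambda>v. v)) \<alpha>) v = G (\<Psi> y) (lift_chart w') \<alpha> (map (\<lambda>v. v) v)"
    by simp
  moreover have "adjoint (\<lambda>v::'e. v) = (\<lambda>v. v)" by (rule adjoint_unique) simp
  ultimately show ?thesis by simp
qed

lemma lift_tfield_at:
  assumes "tensor_field A h k G" "w \<in> D" "y \<in> sheet_at w" "length \<alpha> = h" "length v = k"
  shows "G (\<Psi> y) (lift_chart w) \<alpha> v = lift_tfield G y \<alpha> v"
proof -
  have y: "y \<in> D" using assms(2,3) sheet_at_subset by auto
  show ?thesis
    using lift_tfield_chart[OF assms(1-3), of "\<lambda>_. 0" y] assms(4,5) y sheet_at(2)[OF y]
    by (simp add: tvec_zero lift_tfield_def)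
qed

lemma lift_tfield_periodic:
  assumes G: "tensor_field A h k G" and eq: "\<Psi> w = \<Psi> w'" and w: "w \<in> D" "w' \<in> D"
    and len: "length \<alpha> = h" "length v = k"
  shows "lift_tfield G w \<alpha> v = lift_tfield G w' \<alpha> v"
proof -
  obtain s where s: "w' = w + tvec p s" "\<And>i. i < p \<Longrightarrow> s i \<in> \<int>"
    using \<Psi>_eqD[OF eq w] by blast
  show ?thesis
    using lift_tfield_chart[OF G w(1) sheet_at(2)[OF w(1)] _ w(2) s(2) len] sheet_at(2)[OF w(2)] s(1) eq
    by (simp add: lift_tfield_def)
qed

lemma lift_tfield_eventually:
  assumes "tensor_field A h k G" "w \<in> D" "y \<in> sheet_at w" "length \<alpha> = h" "length v = k"
  shows "\<forall>\<^sub>F u in nhds y. G (cinv (lift_chart w) u) (lift_chart w) \<alpha> v = lift_tfield G u \<alpha> v"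
  using eventually_sheet[OF assms(2,3)]
  by eventually_elim (simp add: lift_tfield_at[OF assms(1,2) _ assms(4,5)] cinv_lift_chart[OF assms(2)])

lemma lift_tfield_differentiable:
  assumes G: "tensor_field A h k G" and w: "w \<in> D" and len: "length \<alpha> = h" "length v = k"
  shows "(\<lambda>u. lift_tfield G u \<alpha> v) differentiable (at w)"
proof -
  have "smooth_on (cmap (lift_chart w) ` cdom (lift_chart w)) (\<lambda>y. G (cinv (lift_chart w) y) (lift_chart w) \<alpha> v)"
    using G lift_chart_in_atlas[OF w] len unfolding tensor_field_def by blast
  then have "(\<lambda>y. G (cinv (lift_chart w) y) (lift_chart w) \<alpha> v) differentiable (at w)"
    by (rule smooth_on_imp_differentiable) (simp add: cmap_image_lift_chart w sheet_at)
  then show ?thesis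
    using frechet_derivative_cong_nhds(1)[OF lift_tfield_eventually[OF G w sheet_at(2)[OF w] len]]
    by simp
qed

lemma lift_lie_derivative:
  assumes X: "vector_field A X" and G: "tensor_field A h k G"
    and inv: "invariant_under_vfield A h k X G"
    and w: "w \<in> D" and len: "length \<alpha> = h" "length v = k"
  defines "L \<equiv> frechet_derivative (lift_vfield X) (at w)"
  shows "frechet_derivative (\<lambda>u. lift_tfield G u \<alpha> v) (at w) (lift_vfield X w) =
     (\<Sum>i<h. lift_tfield G w (\<alpha>[i := adjoint L (\<alpha> ! i)]) v)
     - (\<Sum>i<k. lift_tfield G w \<alpha> (v[i := L (v ! i)]))"
proof -
  note s = sheet_at(2)[OF w]
  have "lie_deriv X G (\<Psi> w) (lift_chart w) \<alpha> v = 0"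
    using inv \<Psi>_in_carrier[OF w] lift_chart_charts_at[OF w s] len
    unfolding invariant_under_vfield_def by blast
  then show ?thesis
    using frechet_derivative_cong_nhds(2)[OF lift_tfield_eventually[OF G w s len]] len
    by (simp add: lie_deriv_def lift_vfield_differentiable(2)[OF X w] cmap_lift_chart[OF w s] L_def
        lift_tfield_def lift_vfield_def)
qed

section \<open>Integral curves and tori\<close>

lemma open_image_\<Psi>:
  assumes "open S" "S \<subseteq> D"
  shows "open (\<Psi> ` S)"
proof -
  have "\<exists>T. open T \<and> \<Psi> w \<in> T \<and> T \<subseteq> \<Psi> ` S" if w: "w \<in> S" for w
  proof (intro exI conjI)
    have wD: "w \<in> D" using w assms by auto
    note s = sheet_at(2)[OF wD]
    have c: "is_chart (lift_chart w)"
      using manifold lift_chart_in_atlas[OF wD] unfolding smooth_manifold_def by blast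
    then have "continuous_on (cdom (lift_chart w)) (cmap (lift_chart w))"
      unfolding is_chart_def homeomorphism_def by blast
    then show "open (cdom (lift_chart w) \<inter> cmap (lift_chart w) -` S)"
      using c assms(1) by (intro continuous_open_preimage) (auto simp: is_chart_def)
    show "\<Psi> w \<in> cdom (lift_chart w) \<inter> cmap (lift_chart w) -` S"
      using s w by (simp add: cdom_lift_chart cmap_lift_chart[OF wD])
    show "cdom (lift_chart w) \<inter> cmap (lift_chart w) -` S \<subseteq> \<Psi> ` S"
      by (auto simp: cdom_lift_chart cmap_lift_chart[OF wD])
  qed
  then show ?thesis by (subst open_subopen) blast
qed

lemma curve_eventually_in_sheet:
  assumes \<gamma>: "integral_curve A Y I \<gamma>" and I: "open I" "t \<in> I" and w: "w \<in> D" "\<gamma> t = \<Psi> w"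
  shows "\<forall>\<^sub>F u in nhds t. \<gamma> u \<in> \<Psi> ` sheet_at w"
proof -
  have "isCont \<gamma> t"
    using \<gamma> I unfolding integral_curve_def by (simp add: continuous_on_eq_continuous_at)
  then have "(\<gamma> \<longlongrightarrow> \<gamma> t) (nhds t)" by (rule isCont_imp_tendsto_nhds)
  then show ?thesis
  proof (rule topological_tendstoD)
    show "open (\<Psi> ` sheet_at w)"
      using w by (intro open_image_\<Psi> open_sheet_at sheet_at_subset)
    show "\<gamma> t \<in> \<Psi> ` sheet_at w" using w sheet_at(2) by auto
  qed
qed

text \<open>
  The \<open>F j\<close> are constant along the curve, which is connected and therefore cannot leave the
  component of the joint level set in which it starts.
\<close>

lemma curve_in_torus:
  assumes F: "\<And>j. j < q \<Longrightarrow> smooth_function A (F j)"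
    and YF: "\<And>x c j. x \<in> carrier A \<Longrightarrow> c \<in> charts_at A x \<Longrightarrow> j < q \<Longrightarrow>
               differential (F j) x c (Y x c) = 0"
    and level: "level_set A q F (range (\<lambda>s. \<rho> s (\<Psi> w)))" and w: "w \<in> D"
    and \<gamma>: "integral_curve A Y {a<..<b} \<gamma>" "\<gamma> t0 = \<Psi> w" "t0 \<in> {a<..<b}" "t \<in> {a<..<b}"
  obtains s where "\<gamma> t = \<Psi> (w + tvec p s)"
proof -
  let ?I = "{a<..<b}" and ?T = "range (\<lambda>s. \<rho> s (\<Psi> w))"
  obtain d where T: "?T \<in> components {x \<in> carrier A. \<forall>j<q. F j x = d j}" (is "_ \<in> components ?S")
    using level unfolding level_set_def by blast
  have "\<Psi> (w + tvec p (\<lambda>_. 0)) \<in> ?T" unfolding \<Psi>_translate[OF w] by blast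
  then have wT: "\<Psi> w \<in> ?T" by (simp add: tvec_zero)
  have in_S: "\<gamma> u \<in> ?S" if u: "u \<in> ?I" for u
  proof -
    have "F j (\<gamma> u) = d j" if j: "j < q" for j
    proof -
      have "((\<lambda>u. F j (\<gamma> u)) has_field_derivative 0) (at u within ?I)" if u: "u \<in> ?I" for u
      proof -
        have cu: "\<gamma> u \<in> carrier A" using \<gamma>(1) u by (auto simp: integral_curve_def)
        then obtain c where c: "c \<in> charts_at A (\<gamma> u)" by (auto simp: carrier_def charts_at_def)
        then have "smooth_on (cmap c ` cdom c) (\<lambda>y. F j (cinv c y))"
          using F[OF j] by (auto simp: smooth_function_def charts_at_def)
        then have "(\<lambda>y. F j (cinv c y)) differentiable (at (cmap c (\<gamma> u)))"
          by (rule smooth_on_imp_differentiable) (use c in \<open>auto simp: charts_at_def\<close>)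
        from integral_curve_derivative[where f = "F j", OF manifold \<gamma>(1) open_greaterThanLessThan u c this]
        have "((\<lambda>u. F j (\<gamma> u)) has_real_derivative differential (F j) (\<gamma> u) c (Y (\<gamma> u) c)) (at u)"
          by (simp add: differential_def)
        then show ?thesis
          unfolding YF[OF cu c j] by (rule has_field_derivative_at_within)
      qed
      from has_field_derivative_zero_constant[OF convex_real_interval(8) this]
      obtain e where "\<And>u. u \<in> ?I \<Longrightarrow> F j (\<gamma> u) = e" by blast
      then have "F j (\<gamma> u) = F j (\<Psi> w)" using \<gamma>(2,3) u by metis
      also have "\<dots> = d j" using wT in_components_subset[OF T] j by blast
      finally show ?thesis .
    qed
    then show ?thesis using \<gamma>(1) u by (auto simp: integral_curve_def)
  qed
  have "connected (\<gamma> ` ?I)"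
    using \<gamma>(1) by (intro connected_continuous_image) (auto simp: integral_curve_def)
  then have "\<gamma> ` ?I \<subseteq> ?T"
    by (rule components_maximal[OF T]) (use in_S wT \<gamma>(2,3) in \<open>force+\<close>)
  then obtain s where "\<gamma> t = \<rho> s (\<Psi> w)" using \<gamma>(4) by blast
  then show thesis using that \<Psi>_translate[OF w] by metis
qed

text \<open>
  In the sheet at \<open>w\<close> the curve moves inside \<open>w + V\<close>: a point of the sheet above the torus of \<open>w\<close>
  differs from a translate of \<open>w\<close> by a period, which again lies in \<open>V\<close>.
\<close>

lemma curve_tangent_to_torus:
  assumes \<gamma>: "integral_curve A Y I \<gamma>" and I: "open I" "t \<in> I" and w: "w \<in> D" "\<gamma> t = \<Psi> w"
    and torus: "\<And>u. u \<in> I \<Longrightarrow> \<exists>s. \<gamma> u = \<Psi> (w + tvec p s)"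
  shows "lift_vfield Y w \<in> range (tvec p)"
proof (rule has_vector_derivative_in_subspace[OF _ subspace_tvec])
  let ?c = "lift_chart w"
  note s = sheet_at(2)[OF w(1)]
  have "?c \<in> charts_at A (\<gamma> t)" using w s lift_chart_charts_at by simp
  then have "((\<lambda>u. cmap ?c (\<gamma> u)) has_vector_derivative Y (\<gamma> t) ?c) (at t)"
    using \<gamma> I unfolding integral_curve_def by blast
  then show "((\<lambda>u. cmap ?c (\<gamma> u)) has_vector_derivative lift_vfield Y w) (at t)"
    by (simp add: lift_vfield_def w)
  have "\<forall>\<^sub>F u in nhds t. cmap ?c (\<gamma> u) - cmap ?c (\<gamma> t) \<in> range (tvec p)"
    using curve_eventually_in_sheet[OF \<gamma> I w] eventually_nhds_in_open[OF I]
  proof eventually_elim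
    case (elim u)
    then obtain y where y: "y \<in> sheet_at w" "\<gamma> u = \<Psi> y" by auto
    obtain s' where s': "\<gamma> u = \<Psi> (w + tvec p s')" using torus elim by blast
    obtain s'' where s'': "y = (w + tvec p s') + tvec p s''"
      using \<Psi>_eqD[of "w + tvec p s'" y] y s' w(1) D_translate sheet_at_subset by (metis subsetD)
    have "cmap ?c (\<gamma> u) - cmap ?c (\<gamma> t) = tvec p s' + tvec p s''"
      using y s w cmap_lift_chart s'' by simp
    then show ?case by (simp only:) (intro subspace_add subspace_tvec rangeI)
  qed
  then show "\<forall>\<^sub>F u in at t. cmap ?c (\<gamma> u) - cmap ?c (\<gamma> t) \<in> range (tvec p)"
    by (simp add: eventually_at_filter eventually_mono)
qed

section \<open>The tensor field along the lifted vector field\<close>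

lemma lift_vfield_derivative_translate:
  assumes Y: "\<And>s. vfield_preserved A U (\<rho> s) Y" "vector_field A Y" and w: "w \<in> D"
  shows "frechet_derivative (lift_vfield Y) (at (w + tvec p s)) = frechet_derivative (lift_vfield Y) (at w)"
proof -
  let ?f = "lift_vfield Y"
  have "((\<lambda>u. u + tvec p s) has_derivative (\<lambda>v. v)) (at w)"
    by (auto intro!: derivative_eq_intros)
  moreover have "(?f has_derivative frechet_derivative ?f (at (w + tvec p s))) (at (w + tvec p s))"
    using lift_vfield_differentiable(1)[OF Y(2) D_translate[OF w]] frechet_derivative_works by blast
  ultimately have "((\<lambda>u. ?f (u + tvec p s)) has_derivative frechet_derivative ?f (at (w + tvec p s))) (at w)"
    using diff_chain_at[of "\<lambda>u. u + tvec p s" "\<lambda>v. v" w ?f] by (simp add: o_def)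
  moreover have "\<forall>\<^sub>F u in nhds w. ?f (u + tvec p s) = ?f u"
    using eventually_nhds_in_open[OF D_open w]
    by eventually_elim (simp add: lift_vfield_translate[OF Y(1)])
  ultimately have "(?f has_derivative frechet_derivative ?f (at (w + tvec p s))) (at w)"
    by (rule has_derivative_cong_nhds[THEN iffD1, rotated])
  then show ?thesis by (rule frechet_derivative_at)
qed

text \<open>
  The image of the derivative lies in \<open>V\<close> because the field has values there, and \<open>V\<close> lies in the
  kernel because the field is invariant under translations by \<open>V\<close>.
\<close>

lemma lift_vfield_derivative_square:
  assumes Y: "\<And>s. vfield_preserved A U (\<rho> s) Y" "vector_field A Y" and w: "w \<in> D"
    and tangent: "\<And>w. w \<in> D \<Longrightarrow> lift_vfield Y w \<in> range (tvec p)"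
  defines "L \<equiv> frechet_derivative (lift_vfield Y) (at w)"
  shows "L (L v) = 0" "adjoint L (adjoint L v) = 0"
proof -
  note d = lift_vfield_differentiable(1)[OF Y(2) w]
  have lin: "linear L" unfolding L_def by (rule linear_frechet_derivative[OF d])
  have "\<forall>\<^sub>F y in nhds w. lift_vfield Y y - lift_vfield Y w \<in> range (tvec p)"
    using eventually_nhds_in_open[OF D_open w]
    by eventually_elim (intro subspace_diff[OF subspace_tvec] tangent w)
  then have im: "L v \<in> range (tvec p)" for v
    unfolding L_def by (rule frechet_derivative_in_subspace[OF d subspace_tvec])
  have ker: "L (tvec p s) = 0" for s
  proof -
    have "(\<lambda>t::real. lift_vfield Y (w + t *\<^sub>R tvec p s)) = (\<lambda>t. lift_vfield Y w)"
      using lift_vfield_translate[OF Y(1) w] by (simp flip: tvec_scale)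
    then have "((\<lambda>t::real. lift_vfield Y w) has_vector_derivative L (tvec p s)) (at 0)"
      using frechet_derivative_along_line[of "lift_vfield Y" w 0 "tvec p s"] d by (simp add: L_def)
    then show ?thesis
      using vector_derivative_unique_at has_vector_derivative_const by blast
  qed
  show LL: "L (L v) = 0" for v using im[of v] ker by auto
  have "x \<bullet> adjoint L (adjoint L v) = 0" for x
    by (simp add: adjoint_works[OF lin] LL)
  then show "adjoint L (adjoint L v) = 0" using inner_eq_zero_iff by blast
qed

text \<open>
  By periodicity the parameters \<open>s\<close> can be taken in the unit cube, whose points satisfy
  \<open>norm (tvec p s) \<le> R\<close> for the constant \<open>R\<close> of the proof; continuity on a compact set does the rest.
\<close>

lemma lift_tfield_bounded_on_torus:
  assumes G: "tensor_field A h k G" and w: "w \<in> D" and len: "length \<alpha> = h" "length v = k"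
  shows "bounded (range (\<lambda>s. lift_tfield G (w + tvec p s) \<alpha> v))"
proof -
  let ?g = "\<lambda>u. lift_tfield G u \<alpha> v"
  define R where "R = (\<Sum>i<p. norm (bvec i :: 'e))"
  define K where "K = (+) w ` (range (tvec p) \<inter> cball 0 R)"
  have "compact K"
    unfolding K_def
    by (intro compact_translation closed_Int_compact closed_subspace subspace_tvec compact_cball)
  moreover have "K \<subseteq> D" unfolding K_def using D_translate[OF w] by auto
  then have "continuous_on K ?g"
    using lift_tfield_differentiable[OF G _ len]
    by (intro continuous_at_imp_continuous_on ballI differentiable_imp_continuous_within) auto
  ultimately have "bounded (?g ` K)"
    using compact_continuous_image compact_imp_bounded by blast
  moreover have "range (\<lambda>s. ?g (w + tvec p s)) \<subseteq> ?g ` K"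
  proof clarify
    fix s :: "nat \<Rightarrow> real"
    let ?s = "\<lambda>i. frac (s i)"
    have "norm (tvec p ?s :: 'e) \<le> R"
      unfolding R_def tvec_def
      by (intro sum_norm_le) (simp add: mult_left_le_one_le frac_lt_1 less_imp_le)
    then have "w + tvec p ?s \<in> K" by (auto simp: K_def)
    moreover have "w + tvec p s = (w + tvec p ?s) + tvec p (\<lambda>i. of_int \<lfloor>s i\<rfloor>)"
      unfolding add.assoc tvec_add[symmetric] by (simp add: frac_def)
    then have "\<Psi> (w + tvec p s) = \<Psi> (w + tvec p ?s)"
      by (simp only: \<Psi>_periodic[OF D_translate[OF w]] Ints_of_int)
    then have "?g (w + tvec p s) = ?g (w + tvec p ?s)"
      by (rule lift_tfield_periodic[OF G _ _ _ len]) (use w in \<open>auto intro: D_translate\<close>)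
    ultimately show "?g (w + tvec p s) \<in> ?g ` K" by (rule rev_image_eqI)
  qed
  ultimately show ?thesis by (rule bounded_subset)
qed

lemma lift_tfield_slot_zero:
  assumes G: "tensor_field A h k G" and w: "w \<in> D" and len: "length \<alpha> = h" "length v = k"
  shows "i < h \<Longrightarrow> lift_tfield G w (\<alpha>[i := 0]) v = 0"
    "i < k \<Longrightarrow> lift_tfield G w \<alpha> (v[i := 0]) = 0"
proof -
  have *: "(\<forall>r<h. linear (\<lambda>a. G (\<Psi> w) (lift_chart w) (\<alpha>[r := a]) v)) \<and>
        (\<forall>s<k. linear (\<lambda>u. G (\<Psi> w) (lift_chart w) \<alpha> (v[s := u])))"
    using G \<Psi>_in_carrier[OF w] lift_chart_charts_at[OF w sheet_at(2)[OF w]] len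
    unfolding tensor_field_def by blast
  show "i < h \<Longrightarrow> lift_tfield G w (\<alpha>[i := 0]) v = 0"
    using linear_0 * unfolding lift_tfield_def by blast
  show "i < k \<Longrightarrow> lift_tfield G w \<alpha> (v[i := 0]) = 0"
    using linear_0 * unfolding lift_tfield_def by blast
qed

text \<open>
  The straight line through \<open>w\<close> in the direction of the field is an integral curve over a single
  torus. Along it the derivative of the field does not change, so the vanishing Lie derivative is a
  flow as in \<open>bounded_tensor_flow_constant\<close>.
\<close>

lemma lift_tfield_derivative_zero:
  assumes Y: "\<And>s. vfield_preserved A U (\<rho> s) Y" "vector_field A Y" and w: "w \<in> D"
    and tangent: "\<And>w. w \<in> D \<Longrightarrow> lift_vfield Y w \<in> range (tvec p)"
    and G: "tensor_field A h k G" "invariant_under_vfield A h k Y G"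
    and len: "length \<alpha> = h" "length v = k"
  shows "frechet_derivative (\<lambda>u. lift_tfield G u \<alpha> v) (at w) (lift_vfield Y w) = 0"
proof -
  obtain s where s: "lift_vfield Y w = tvec p s" using tangent[OF w] by blast
  let ?l = "\<lambda>t::real. w + t *\<^sub>R tvec p s"
  define L where "L = frechet_derivative (lift_vfield Y) (at w)"
  have line: "?l t = w + tvec p (\<lambda>i. t * s i)" for t by (simp add: tvec_scale)
  have lD: "?l t \<in> D" for t unfolding line by (rule D_translate[OF w])
  have along: "((\<lambda>t. lift_tfield G (?l t) \<alpha> v) has_real_derivative
      frechet_derivative (\<lambda>u. lift_tfield G u \<alpha> v) (at (?l t)) (tvec p s)) (at t)"
    if "length \<alpha> = h" "length v = k" for \<alpha> v t
    using frechet_derivative_along_line[of "\<lambda>u. lift_tfield G u \<alpha> v" w t "tvec p s"]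
      lift_tfield_differentiable[OF G(1) lD that]
    by (simp add: has_real_derivative_iff_has_vector_derivative)
  have const: "lift_tfield G (?l t) \<alpha> v = lift_tfield G (?l 0) \<alpha> v" for t
  proof (rule bounded_tensor_flow_constant[where g = "\<lambda>t. lift_tfield G (?l t)" and h = h and k = k
        and L = L and M = "adjoint L"])
    show "L (L x) = 0" "adjoint L (adjoint L x) = 0" for x
      unfolding L_def by (rule lift_vfield_derivative_square[OF Y w tangent]; assumption)+
    show "((\<lambda>t. lift_tfield G (?l t) \<alpha> v) has_real_derivative
        (\<Sum>i<h. lift_tfield G (?l t) (\<alpha>[i := adjoint L (\<alpha> ! i)]) v)
        - (\<Sum>i<k. lift_tfield G (?l t) \<alpha> (v[i := L (v ! i)]))) (at t)"
      if "length \<alpha> = h" "length v = k" for \<alpha> v t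
    proof -
      have "frechet_derivative (lift_vfield Y) (at (?l t)) = L"
        unfolding line L_def by (rule lift_vfield_derivative_translate[OF Y w])
      moreover have "lift_vfield Y (?l t) = tvec p s"
        unfolding line lift_vfield_translate[OF Y(1) w] by (rule s)
      ultimately show ?thesis
        using along[OF that, of t] lift_lie_derivative[OF Y(2) G lD[of t] that] by simp
    qed
    show "bounded (range (\<lambda>t. lift_tfield G (?l t) \<alpha> v))"
      if "length \<alpha> = h" "length v = k" for \<alpha> v
      unfolding line
      by (rule bounded_subset[OF lift_tfield_bounded_on_torus[OF G(1) w that]]) auto
  qed (use lift_tfield_slot_zero[OF G(1) lD] len in auto)
  have "((\<lambda>t. lift_tfield G (?l t) \<alpha> v) has_real_derivative 0) (at 0)"
    by (subst const) simp
  then show ?thesis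
    using along[OF len, of 0] DERIV_unique s by fastforce
qed

lemma lift_tfield_isCont:
  assumes "tensor_field A h k G" "w \<in> D" "length \<alpha> = h" "length v = k"
  shows "isCont (\<lambda>u. lift_tfield G u \<alpha> v) w"
  using lift_tfield_differentiable[OF assms] by (rule differentiable_imp_continuous_within)

text \<open>
  By periodicity the component of the tensor descends to a function \<open>f\<close> on \<open>U\<close>, which can be
  differentiated along the curve in \<open>U\<close> itself, without lifting the curve to the cylinder.
\<close>

lemma lift_tfield_const_on_curve:
  assumes G: "tensor_field A h k G" and len: "length \<alpha> = h" "length v = k"
    and zero: "\<And>w. w \<in> D \<Longrightarrow>
      frechet_derivative (\<lambda>u. lift_tfield G u \<alpha> v) (at w) (lift_vfield Y w) = 0"
    and \<gamma>: "integral_curve A Y {a<..<b} \<gamma>" "\<gamma> ` {a<..<b} \<subseteq> U"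
    and t: "t \<in> {a<..<b}" "t' \<in> {a<..<b}"
    and w: "w \<in> D" "\<gamma> t = \<Psi> w" and w': "w' \<in> D" "\<gamma> t' = \<Psi> w'"
  shows "lift_tfield G w \<alpha> v = lift_tfield G w' \<alpha> v"
proof -
  define f where "f x = lift_tfield G (inv_into D \<Psi> x) \<alpha> v" for x
  have f: "f (\<Psi> y) = lift_tfield G y \<alpha> v" if y: "y \<in> D" for y
    unfolding f_def
    by (rule lift_tfield_periodic[OF G _ _ y len])
      (use y in \<open>auto intro: f_inv_into_f inv_into_into\<close>)
  have "((\<lambda>u. f (\<gamma> u)) has_field_derivative 0) (at u within {a<..<b})" if u: "u \<in> {a<..<b}" for u
  proof -
    obtain y where y: "y \<in> D" "\<gamma> u = \<Psi> y" using \<gamma>(2) u image_D by blast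
    let ?c = "lift_chart y"
    note s = sheet_at(2)[OF y(1)]
    have ev: "\<forall>\<^sub>F z in nhds y. f (cinv ?c z) = lift_tfield G z \<alpha> v"
      using eventually_sheet[OF y(1) s]
      by eventually_elim
        (simp add: cinv_lift_chart[OF y(1)] f subsetD[OF sheet_at_subset[OF y(1)]])
    have c: "?c \<in> charts_at A (\<gamma> u)" using lift_chart_charts_at[OF y(1) s] y(2) by simp
    have cy: "cmap ?c (\<gamma> u) = y" using cmap_lift_chart[OF y(1) s] y(2) by simp
    have "(\<lambda>z. f (cinv ?c z)) differentiable (at (cmap ?c (\<gamma> u)))"
      unfolding cy frechet_derivative_cong_nhds(1)[OF ev]
      by (rule lift_tfield_differentiable[OF G y(1) len])
    note der = integral_curve_derivative[where f = f, OF manifold \<gamma>(1) open_greaterThanLessThan u c this]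
    have "frechet_derivative (\<lambda>z. f (cinv ?c z)) (at (cmap ?c (\<gamma> u))) (Y (\<gamma> u) ?c) = 0"
      unfolding cy frechet_derivative_cong_nhds(2)[OF ev]
      using zero[OF y(1)] by (simp add: lift_vfield_def y(2))
    with der have "((\<lambda>u. f (\<gamma> u)) has_real_derivative 0) (at u)" by (simp only:)
    then show ?thesis by (rule has_field_derivative_at_within)
  qed
  from has_field_derivative_zero_constant[OF convex_real_interval(8) this]
  obtain e where "\<And>u. u \<in> {a<..<b} \<Longrightarrow> f (\<gamma> u) = e" by blast
  then have "f (\<gamma> t) = f (\<gamma> t')" using t by metis
  then show ?thesis using f w w' by simp
qed

text \<open>
  In arbitrary charts \<open>c\<close> and \<open>c'\<close>, the tangent map of \<open>\<rho> s\<close> factors as a change of charts \<open>P\<close> into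
  the sheet at \<open>w\<close>, the translation by \<open>tvec p s\<close> with identity derivative, and a change of charts
  \<open>Q\<close> out of the sheet at the translated point. The tensor transforms correctly under \<open>P\<close> and \<open>Q\<close>.
\<close>

lemma tfield_preserved_of_lift:
  assumes G: "tensor_field A h k G"
    and inv: "\<And>w \<alpha> v. w \<in> D \<Longrightarrow> length \<alpha> = h \<Longrightarrow> length v = k \<Longrightarrow>
       lift_tfield G (w + tvec p s) \<alpha> v = lift_tfield G w \<alpha> v"
  shows "tfield_preserved A h k U (\<rho> s) G"
  unfolding tfield_preserved_def
proof (intro ballI allI impI, elim conjE)
  fix x c c' and \<beta> v :: "'e list"
  assume "x \<in> U" and c: "c \<in> charts_at A x" and c': "c' \<in> charts_at A (\<rho> s x)"
    and len: "length \<beta> = h" "length v = k"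
  then obtain w where w: "w \<in> D" "x = \<Psi> w" using image_D by blast
  let ?w = "w + tvec p s"
  have w': "?w \<in> D" "\<rho> s x = \<Psi> ?w" using D_translate \<Psi>_translate w by simp_all
  let ?l = "lift_chart w" and ?l' = "lift_chart ?w"
  have cA: "c \<in> A" "x \<in> cdom c" using c by (auto simp: charts_at_def)
  have l: "?l \<in> charts_at A x" "?l' \<in> charts_at A (\<rho> s x)"
    using lift_chart_charts_at sheet_at(2) w w' by simp_all
  define P where "P = tangent_map c ?l id x"
  define Q where "Q = tangent_map ?l' c' id (\<rho> s x)"
  let ?\<phi> = "\<lambda>y. cmap ?l (cinv c y)" and ?\<psi> = "\<lambda>y. cmap c' (cinv ?l' y)"
  have d\<phi>: "?\<phi> differentiable (at (cmap c x))" by (rule transition_differentiable[OF manifold c l(1)])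
  then have P: "(?\<phi> has_derivative P) (at (cmap c x))"
    unfolding P_def tangent_map_def by (simp add: frechet_derivative_works)
  have w'_eq: "cmap ?l' (\<rho> s x) = ?w"
    using w' cmap_lift_chart sheet_at(2) by simp
  have d\<psi>: "?\<psi> differentiable (at ?w)"
    using transition_differentiable[OF manifold l(2) c'] unfolding w'_eq .
  then have Q: "(?\<psi> has_derivative Q) (at ?w)"
    unfolding Q_def tangent_map_def w'_eq by (simp add: frechet_derivative_works)
  have \<phi>x: "?\<phi> (cmap c x) = w"
    using smooth_manifold_chart(2)[OF manifold cA] w cmap_lift_chart sheet_at(2) by simp
  have "((\<lambda>y. ?\<phi> y + tvec p s) has_derivative P) (at (cmap c x))"
    using P by (auto intro!: derivative_eq_intros)
  moreover have "(?\<psi> has_derivative Q) (at (?\<phi> (cmap c x) + tvec p s))"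
    unfolding \<phi>x by (rule Q)
  ultimately have "(?\<psi> \<circ> (\<lambda>y. ?\<phi> y + tvec p s) has_derivative Q \<circ> P) (at (cmap c x))"
    by (rule diff_chain_at)
  moreover have "\<forall>\<^sub>F y in nhds (cmap c x). (?\<psi> \<circ> (\<lambda>y. ?\<phi> y + tvec p s)) y = cmap c' (\<rho> s (cinv c y))"
  proof -
    have cont: "(cinv c \<longlongrightarrow> x) (nhds (cmap c x))"
      using isCont_imp_tendsto_nhds[OF smooth_manifold_chart(3)[OF manifold cA]]
      by (simp only: smooth_manifold_chart(2)[OF manifold cA])
    have "isCont ?\<phi> (cmap c x)" using d\<phi> by (rule differentiable_imp_continuous_within)
    from isCont_imp_tendsto_nhds[OF this] have "(?\<phi> \<longlongrightarrow> w) (nhds (cmap c x))"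
      by (simp only: \<phi>x)
    then have tendsto: "((\<lambda>y. ?\<phi> y + tvec p s) \<longlongrightarrow> ?w) (nhds (cmap c x))"
      by (intro tendsto_intros)
    have xs: "x \<in> \<Psi> ` sheet_at w" using w sheet_at(2) by auto
    from topological_tendstoD[OF tendsto open_sheet_at[OF w'(1)] sheet_at(2)[OF w'(1)]]
      topological_tendstoD[OF cont open_image_\<Psi>[OF open_sheet_at[OF w(1)] sheet_at_subset[OF w(1)]] xs]
    show ?thesis
    proof eventually_elim
      case (elim y)
      then obtain z where z: "z \<in> sheet_at w" "cinv c y = \<Psi> z" by auto
      then have "?\<phi> y = z" "z \<in> D" using cmap_lift_chart[OF w(1)] sheet_at_subset[OF w(1)] by auto
      then show ?case
        using elim(1) z(2) cinv_lift_chart[OF w'(1)] \<Psi>_translate by simp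
    qed
  qed
  ultimately have "((\<lambda>y. cmap c' (\<rho> s (cinv c y))) has_derivative Q \<circ> P) (at (cmap c x))"
    by (rule has_derivative_cong_nhds[THEN iffD1, rotated])
  then have T: "tangent_map c c' (\<rho> s) x = Q \<circ> P"
    unfolding tangent_map_def by (rule frechet_derivative_at[symmetric])
  have lin: "linear P" "linear Q"
    using P Q has_derivative_linear by blast+
  have adj: "adjoint (Q \<circ> P) = adjoint P \<circ> adjoint Q"
    by (rule adjoint_unique) (simp add: adjoint_works lin)
  have id: "tfield_preserved A h k (carrier A) id G"
    using G unfolding tensor_field_def by blast
  have car: "x \<in> carrier A" "\<rho> s x \<in> carrier A"
    using \<Psi>_in_carrier w w' by simp_all
  have "G x c (map (adjoint P) (map (adjoint Q) \<beta>)) v = G x ?l (map (adjoint Q) \<beta>) (map P v)"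
    using tfield_preservedD[OF id car(1) c, of ?l "map (adjoint Q) \<beta>" v] l(1) len
    by (simp add: P_def)
  also have "\<dots> = G (\<rho> s x) ?l' (map (adjoint Q) \<beta>) (map P v)"
    using inv[OF w(1), of "map (adjoint Q) \<beta>" "map P v"] len
    by (simp only: length_map lift_tfield_def w(2) w'(2) simp_thms) (metis w(2) w'(2))
  also have "\<dots> = G (\<rho> s x) c' \<beta> (map Q (map P v))"
    using tfield_preservedD[OF id car(2) l(2), of c' \<beta> "map P v"] c' len
    by (simp add: Q_def)
  finally show "G x c (map (adjoint (tangent_map c c' (\<rho> s) x)) \<beta>) v =
      G (\<rho> s x) c' \<beta> (map (tangent_map c c' (\<rho> s) x) v)"
    unfolding T adj by simp
qed

end

section \<open>Invariance under the torus action\<close>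

theorem theorem2p4:
  fixes A :: "('m::{t2_space, second_countable_topology}, 'e::euclidean_space) chart set"
    and p q h k :: nat
    and X :: "nat \<Rightarrow> ('m, 'e) vfield"
    and F :: "nat \<Rightarrow> 'm \<Rightarrow> real"
    and N U :: "'m set"
    and \<rho> :: "(nat \<Rightarrow> real) \<Rightarrow> 'm \<Rightarrow> 'm"
    and \<Psi> :: "'e \<Rightarrow> 'm"
    and r :: real
    and G :: "('m, 'e) tfield"
  assumes manifold: "smooth_manifold A"
    and system: "integrable_system A p q X F"
    and torus: "liouville_torus A p q X F N"
    and action: "liouville_torus_action A p q X F U \<rho>"
    and coordinates: "liouville_coordinates A p r U \<rho> \<Psi>"
    and core: "N = torus_at p \<Psi> 0"
    and dense: "zball p r \<subseteq> closure {z \<in> zball p r.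
           \<forall>x \<in> torus_at p \<Psi> z. torus_at p \<Psi> z \<subseteq> closure (orbit A (X 0) x)}"
    and tensor: "tensor_field A h k G"
    and invariant: "invariant_under_vfield A h k (X 0) G"
  shows "\<forall>s. tfield_preserved A h k U (\<rho> s) G"
proof -
  interpret torus_cylinder A p r U \<rho> \<Psi>
    by unfold_locales (fact manifold, fact coordinates)
  let ?Y = "X 0" and ?V = "range (tvec p) :: 'e set"
  define Z where "Z = {z \<in> B. \<forall>x \<in> torus_at p \<Psi> z. torus_at p \<Psi> z \<subseteq> closure (orbit A ?Y x)}"
  have Z: "B \<subseteq> closure Z" "Z \<subseteq> B" using dense by (auto simp: Z_def)
  have Y: "vector_field A ?Y" "\<And>s. vfield_preserved A U (\<rho> s) ?Y"
    using system action by (auto simp: integrable_system_def liouville_torus_action_def)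
  have F: "\<And>j. j < q \<Longrightarrow> smooth_function A (F j)"
    and YF: "\<And>x c j. x \<in> carrier A \<Longrightarrow> c \<in> charts_at A x \<Longrightarrow> j < q \<Longrightarrow>
               differential (F j) x c (?Y x c) = 0"
    using system by (auto simp: integrable_system_def)
  have orbit_in_torus: "\<exists>s. \<gamma> u = \<Psi> (w + tvec p s)"
    if w: "w \<in> D" and \<gamma>: "integral_curve A ?Y {a<..<b} \<gamma>" "\<gamma> 0 = \<Psi> w" "0 \<in> {a<..<b}"
      and u: "u \<in> {a<..<b}" for w a b \<gamma> u
  proof -
    have "\<Psi> w \<in> U" using w image_D by blast
    then have level: "level_set A q F (range (\<lambda>s. \<rho> s (\<Psi> w)))"
      using action by (auto simp: liouville_torus_action_def regular_level_set_def)
    obtain s where "\<gamma> u = \<Psi> (w + tvec p s)"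
      by (rule curve_in_torus[of q F ?Y, OF F YF level w \<gamma> u])
    then show ?thesis by blast
  qed
  have torus_closure: "\<Psi> (w + tvec p s) \<in> closure (orbit A ?Y (\<Psi> w))"
    if w: "w = tvec p t + z" "z \<in> Z" for w s t z
  proof -
    have "w + tvec p s = tvec p (\<lambda>i. t i + s i) + z" using w by (simp add: tvec_add)
    then have "\<Psi> (w + tvec p s) \<in> torus_at p \<Psi> z"
      unfolding torus_at_def by (simp only:) (rule range_eqI[of _ _ "\<lambda>i. t i + s i"], rule refl)
    moreover have "\<Psi> w \<in> torus_at p \<Psi> z"
      unfolding w(1) torus_at_def by (rule rangeI)
    ultimately show ?thesis using w(2) by (auto simp: Z_def)
  qed
  have tangent: "lift_vfield ?Y w \<in> ?V" if "w \<in> D" for w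
  proof -
    obtain t z where w: "w = tvec p t + z" "z \<in> B" using \<open>w \<in> D\<close> by (auto simp: cylinder_def)
    have "lift_vfield ?Y (tvec p t + z) \<in> ?V"
    proof (rule continuous_on_dense_closed[of B "\<lambda>z. lift_vfield ?Y (tvec p t + z)" Z])
      have "isCont (lift_vfield ?Y) u" if "u \<in> D" for u
        using lift_vfield_differentiable(1)[OF Y(1) that]
        by (rule differentiable_imp_continuous_within)
      then have "continuous_on D (lift_vfield ?Y)"
        by (simp add: continuous_at_imp_continuous_on)
      then show "continuous_on B (\<lambda>z. lift_vfield ?Y (tvec p t + z))"
        by (rule continuous_on_compose2) (auto intro!: continuous_intros in_D)
      show "lift_vfield ?Y (tvec p t + z) \<in> ?V" if z: "z \<in> Z" for z
      proof -
        have wD: "tvec p t + z \<in> D" using z Z(2) in_D by auto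
        \<comment> \<open>An integral curve through the point exists because the closure of its orbit is not empty.\<close>
        have "closure (orbit A ?Y (\<Psi> (tvec p t + z))) \<noteq> {}"
          by (rule ex_in_conv[THEN iffD1, OF exI, OF torus_closure[OF refl z]])
        then have "orbit A ?Y (\<Psi> (tvec p t + z)) \<noteq> {}" by simp
        then obtain \<gamma> a b where \<gamma>: "integral_curve A ?Y {a<..<b} \<gamma>" "\<gamma> 0 = \<Psi> (tvec p t + z)"
          "0 \<in> {a<..<b}" unfolding orbit_def by blast
        show ?thesis
          by (rule curve_tangent_to_torus[OF \<gamma>(1) open_greaterThanLessThan \<gamma>(3) wD \<gamma>(2)
                orbit_in_torus[OF wD \<gamma>]])
      qed
    qed (use Z w closed_subspace subspace_tvec in auto)
    then show ?thesis using w by simp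
  qed
  have inv: "lift_tfield G (w + tvec p s) \<alpha> v = lift_tfield G w \<alpha> v"
    if wD: "w \<in> D" and len: "length \<alpha> = h" "length v = k" for w \<alpha> v s
  proof -
    let ?g = "\<lambda>u. lift_tfield G u \<alpha> v"
    obtain t z where w: "w = tvec p t + z" "z \<in> B" using wD by (auto simp: cylinder_def)
    have good: "?g (w + tvec p s) = ?g w" if w: "w = tvec p t + z" "z \<in> Z" for w t z
    proof (rule ccontr)
      assume ne: "?g (w + tvec p s) \<noteq> ?g w"
      have wD: "w \<in> D" using w Z(2) in_D by auto
      have "isCont ?g u" if "u \<in> D" for u by (rule lift_tfield_isCont[OF tensor that len])
      then have "continuous_on D ?g" by (simp add: continuous_at_imp_continuous_on)
      then have "open (D \<inter> ?g -` (- {?g w}))"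
        by (rule continuous_open_preimage) (auto simp: D_open)
      then have "open (\<Psi> ` (D \<inter> ?g -` (- {?g w})))" by (rule open_image_\<Psi>) auto
      moreover have "\<Psi> (w + tvec p s) \<in> \<Psi> ` (D \<inter> ?g -` (- {?g w}))"
        using ne D_translate[OF wD] by auto
      ultimately obtain x where x: "x \<in> orbit A ?Y (\<Psi> w)" "x \<in> \<Psi> ` (D \<inter> ?g -` (- {?g w}))"
        using torus_closure[OF w, of s] unfolding closure_iff_nhds_not_empty by blast
      then obtain y where y: "y \<in> D" "?g y \<noteq> ?g w" "x = \<Psi> y" by auto
      obtain \<gamma> u a b where \<gamma>: "integral_curve A ?Y {a<..<b} \<gamma>" "\<gamma> 0 = \<Psi> w" "0 \<in> {a<..<b}"
        and u: "u \<in> {a<..<b}" "\<Psi> y = \<gamma> u" using x(1) unfolding orbit_def mem_Collect_eq y(3) by metis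
      have "\<gamma> ` {a<..<b} \<subseteq> U"
        using orbit_in_torus[OF wD \<gamma>] D_translate[OF wD] image_D by blast
      from lift_tfield_const_on_curve[OF tensor len
          lift_tfield_derivative_zero[OF Y(2,1) _ tangent tensor invariant len] \<gamma>(1) this u(1) \<gamma>(3)
          y(1) u(2)[symmetric] wD \<gamma>(2)]
      show False using y(2) by simp
    qed
    let ?d = "\<lambda>z. ?g (tvec p t + z + tvec p s) - ?g (tvec p t + z)"
    have "?d z \<in> {0}"
    proof (rule continuous_on_dense_closed[of B ?d Z])
      have "isCont ?g u" if "u \<in> D" for u by (rule lift_tfield_isCont[OF tensor that len])
      then have "continuous_on D ?g" by (simp add: continuous_at_imp_continuous_on)
      then show "continuous_on B ?d"
        by (intro continuous_on_diff; rule continuous_on_compose2)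
          (auto intro!: continuous_intros in_D D_translate)
    qed (use Z w good in auto)
    then show ?thesis using w by simp
  qed
  show ?thesis using tfield_preserved_of_lift[OF tensor inv] by blast
qed

end
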